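(* For every decimal $d\in\mathbb{R}$ there exists a permutation (i.e., a bijection) $\pi\colon X_R\to X_R$ such that the $\pi$-conjugate of the multiplicative $d$-shift $u(x)\mapsto u(d\cdot_Rx)$ ($x\in\mathbb{R}$) on $X_R$ is computable.
   Context: $\mathbb{N}=\{1,2,\dots\}$, $\mathbb{N}_0=\{0,1,2,\dots\}$, $D=\{0,1,\dots,9\}$. **Decimals.** A decimal is a formal infinite linear combination $d=(-)\sum_{n\le k}d_n10^n$ with an optional minus sign, $k\in\mathbb{N}_0$ (the order of $d$), $n\in\mathbb{Z}$, $d_n\in D$, such that (i) $d_k=0$ implies $k=0$; (ii) there is no $n\le k$ with $d_m=9$ for all $m\le n$; (iii) $-\sum_{n\le 0}0\cdot10^n$ is not allowed. Digits $d_n$ with $n>k$ are set to $0$. Two decimals are equal iff they have equal signs, orders and digits. $\mathbb{R}$ denotes the set of decimals. **Multiplication of decimals.** Let $\mathbb{Q}_D\subset\mathbb{Q}$ be the subring of fractions with a finite decimal expansion. For a decimal $d=(-)\sum_{n\le k}d_n10^n\in\mathbb{R}$ of order $k$ and $m\in\mathbb{N}$ let $r(d\,|\,m)=\pm\sum_{-m\le n\le k}d_n10^n\in\mathbb{Q}_D$ (with the sign of $d$) be the value of the $m$-th truncation of $d$. A sequence $(a_n)\subset\mathbb{Q}_D$ is Cauchy if for every $k\in\mathbb{N}$ there is $n_0\in\mathbb{N}$ with $|a_m-a_n|<1/k$ for all $m,n\ge n_0$. A Cauchy sequence $(a_n)\subset\mathbb{Q}_D$ generates $d$, written $d=G(a_n)$,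 if for every $k\in\mathbb{N}$ there is $n_0\in\mathbb{N}$ such that $|r(d\,|\,n)-a_n|<1/k$ for all $n\ge n_0$. Every decimal has a generating sequence and every Cauchy sequence in $\mathbb{Q}_D$ generates exactly one decimal. For $d=G(a_n)$, $e=G(b_n)$ one defines $d\cdot_Re:=G(a_nb_n)$ (independent of the choice of generating sequences). **Encodings and conjugates.** For a nonempty finite alphabet $A$ let $A^{\infty}=A^{\mathbb{N}_0}$ be the set of one-way infinite words over $A$. An encoding is a nonempty subset $X\subset A^\infty$. A unary operation on $X$ is a map $F\colon X\to X$. If $\pi\colon X\to X'$ is a bijection between encodings, the $\pi$-conjugate of $F\colon X\to X$ is the unary operation $F'\colon X'\to X'$, $F'(u)=\pi(F(\pi^{-1}(u)))$. **Canonical encoding $X_R$.** Let $A=D\cup\{-,\xi\}$, with $\xi$ a separation symbol. A decimal $d=(-)\sum_{n\le k}d_n10^n$ of order $k$ is encoded as the word $u(d)\in A^\infty$ consisting of the minus sign if $d$ has one, then the binary digits of $k$ (least significant digit first; $0$ is written as the single digit $0$), then $\xi$, then the digits $d_k,d_{k-1},d_{k-2},\dots$ in this order. $X_R=\{u(d)\mid d\in\mathbb{R}\}$. **Unary machines and computability.** A unary machine $M$ (for an encoding $X\subset A^\infty$) is a Turing machine with a finite set of states containing an initial and a terminal state, and with a finite alphabet $A'\supset A\cup\{0,1,\epsilon\}$, where $\epsilon\in A'\setminus A$ is the empty cell symbol. It operates on two bi-infinite tapes $T_1,T_2$, with cells labeled by $\mathbb{Z}$, via corresponding heads; the head on $T_1$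 only reads, the head on $T_2$ reads and writes. An input is a pair $(x,m)\in X\times\mathbb{N}_0$: the word $x=x_0x_1\dots$ is stored on $T_1$ with $x_n$ in cell $n$ and $\epsilon$ in every cell $n<0$; $m$ is stored in binary on $T_2$ with the least significant digit in cell $0$ and successive digits in cells $1,2,\dots$, all other cells containing $\epsilon$. The computation starts in the initial state with both heads at cell $0$. In each step, if $M$ is in the terminal state the computation terminates; otherwise, depending only on the current state and the contents of the two scanned cells, $M$ rewrites the scanned cell of $T_2$, moves each head by $-1$, $0$ or $+1$, and passes to a new (possibly the same) state, according to its finite instruction table. $M$ computes $F\colon X\to X$ if for every input $(x,m)$ it terminates with $z_m$ in cell $0$ of $T_2$ and $\epsilon$ in all other cells of $T_2$, where $F(x)=z_0z_1\dots$. A unary operation $F$ is computable if some unary machine computes it. *)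

theory Defs
  imports Complex_Main "HOL-Library.FuncSet" "HOL-Library.Omega_Words_Fun"
begin

section \<open>Decimals\<close>

text \<open>
  A decimal is a triple of a sign (True for a minus sign), an order \<open>k\<close> and a digit function,
  extended by zero above the order.
\<close>

definition is_decimal :: "bool \<Rightarrow> nat \<Rightarrow> (int \<Rightarrow> nat) \<Rightarrow> bool" where
  "is_decimal s k f \<longleftrightarrow>
     (\<forall>n. f n \<le> 9) \<and> (\<forall>n>int k. f n = 0) \<and>
     (f (int k) = 0 \<longrightarrow> k = 0) \<and>
     \<not> (\<exists>n\<le>int k. \<forall>m\<le>n. f m = 9) \<and>
     \<not> (s \<and> k = 0 \<and> (\<forall>n\<le>0. f n = 0))"

typedef decimal = "{(s, k, f). is_decimal s k f}"
proof
  show "(False, 0, \<lambda>_. 0) \<in> {(s, k, f). is_decimal s k f}"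
    by (auto simp: is_decimal_def)
qed

definition neg :: "decimal \<Rightarrow> bool" where
  "neg d = fst (Rep_decimal d)"

definition ord :: "decimal \<Rightarrow> nat" where
  "ord d = fst (snd (Rep_decimal d))"

definition digit :: "decimal \<Rightarrow> int \<Rightarrow> nat" where
  "digit d = snd (snd (Rep_decimal d))"

definition QD :: "rat set" where
  "QD = {of_int a / 10 ^ n | (a :: int) (n :: nat). True}"

definition trunc :: "decimal \<Rightarrow> nat \<Rightarrow> rat" where
  "trunc d m =
     (if neg d then - 1 else 1) * (\<Sum>n = - int m..int (ord d). of_nat (digit d n) * 10 powi n)"

text \<open>
  Sequences are indexed by the positive integers; the value at index 0 is irrelevant in the
  following definitions.
\<close>

definition cauchy_QD :: "(nat \<Rightarrow> rat) \<Rightarrow> bool" where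
  "cauchy_QD a \<longleftrightarrow>
     (\<forall>n\<ge>1. a n \<in> QD) \<and>
     (\<forall>k\<ge>1. \<exists>n0\<ge>1. \<forall>m\<ge>n0. \<forall>n\<ge>n0. \<bar>a m - a n\<bar> < 1 / of_nat k)"

definition generates :: "(nat \<Rightarrow> rat) \<Rightarrow> decimal \<Rightarrow> bool" where
  "generates a d \<longleftrightarrow>
     cauchy_QD a \<and>
     (\<forall>k\<ge>1. \<exists>n0\<ge>1. \<forall>n\<ge>n0. \<bar>trunc d n - a n\<bar> < 1 / of_nat k)"

definition decimal_mult :: "decimal \<Rightarrow> decimal \<Rightarrow> decimal" (infixl "\<cdot>\<^sub>R" 70) where
  "d \<cdot>\<^sub>R e = (THE c. \<exists>a b. generates a d \<and> generates b e \<and> generates (\<lambda>n. a n * b n) c)"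


section \<open>Encodings and conjugates\<close>

text \<open>
  A single countable type of symbols from which all finite alphabets are drawn. \<open>Aux i\<close> serves
  for additional tape symbols of machines.
\<close>

datatype symbol = Digit nat | Minus | Sep | Blank | Aux nat

definition encoding :: "symbol set \<Rightarrow> symbol word set \<Rightarrow> bool" where
  "encoding A X \<longleftrightarrow> finite A \<and> A \<noteq> {} \<and> X \<noteq> {} \<and> (\<forall>w\<in>X. range w \<subseteq> A)"

definition conjugate ::
    "symbol word set \<Rightarrow> (symbol word \<Rightarrow> symbol word) \<Rightarrow> (symbol word \<Rightarrow> symbol word)
      \<Rightarrow> symbol word \<Rightarrow> symbol word" where
  "conjugate X \<pi> F = (\<lambda>u. \<pi> (F (inv_into X \<pi> u)))"

text \<open>Binary digits, least significant first; \<open>0\<close> is represented by the single digit \<open>0\<close>.\<close>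

fun binary :: "nat \<Rightarrow> nat list" where
  "binary n = (if n < 2 then [n] else n mod 2 # binary (n div 2))"

declare binary.simps [simp del]

definition A_R :: "symbol set" where
  "A_R = Digit ` {0..9} \<union> {Minus, Sep}"

definition u :: "decimal \<Rightarrow> symbol word" where
  "u d = ((if neg d then [Minus] else []) @ map Digit (binary (ord d)) @ [Sep])
           \<frown> (\<lambda>i. Digit (digit d (int (ord d) - int i)))"

definition X_R :: "symbol word set" where
  "X_R = range u"

text \<open>The map \<open>u x \<mapsto> u (d \<cdot>\<^sub>R x)\<close>; it is well defined as the encoding \<open>u\<close> is injective.\<close>

definition mult_shift :: "decimal \<Rightarrow> symbol word \<Rightarrow> symbol word" where
  "mult_shift d w = u (d \<cdot>\<^sub>R (inv u w))"


section \<open>Unary machines\<close>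

text \<open>
  States are natural numbers, which is no restriction as there are only finitely many. An
  instruction \<open>instr M q a b = (c, \<delta>\<^sub>1, \<delta>\<^sub>2, q')\<close> for the state \<open>q\<close>, the symbol \<open>a\<close> scanned on
  the first and \<open>b\<close> scanned on the second tape consists of the symbol \<open>c\<close> written on the
  second tape, the moves of the two heads and the next state.
\<close>

record machine =
  states :: "nat set"
  start :: nat
  final :: nat
  alphabet :: "symbol set"
  instr :: "nat \<Rightarrow> symbol \<Rightarrow> symbol \<Rightarrow> symbol \<times> int \<times> int \<times> nat"

definition unary_machine :: "symbol set \<Rightarrow> machine \<Rightarrow> bool" where
  "unary_machine A M \<longleftrightarrow>
     finite (states M) \<and> start M \<in> states M \<and> final M \<in> states M \<and>
     finite (alphabet M) \<and> A \<union> {Digit 0, Digit 1, Blank} \<subseteq> alphabet M \<and> Blank \<notin> A \<and>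
     (\<forall>q\<in>states M - {final M}. \<forall>a\<in>alphabet M. \<forall>b\<in>alphabet M.
        instr M q a b \<in> alphabet M \<times> {-1, 0, 1} \<times> {-1, 0, 1} \<times> states M)"

text \<open>A configuration: state, positions of the two heads, content of the second tape.\<close>

type_synonym config = "nat \<times> int \<times> int \<times> (int \<Rightarrow> symbol)"

definition input_tape :: "symbol word \<Rightarrow> int \<Rightarrow> symbol" where
  "input_tape x = (\<lambda>i. if i < 0 then Blank else x (nat i))"

definition index_tape :: "nat \<Rightarrow> int \<Rightarrow> symbol" where
  "index_tape m =
     (\<lambda>i. if 0 \<le> i \<and> nat i < length (binary m) then Digit (binary m ! nat i) else Blank)"

definition initial_config :: "machine \<Rightarrow> nat \<Rightarrow> config" where
  "initial_config M m = (start M, 0, 0, index_tape m)"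

fun step :: "machine \<Rightarrow> (int \<Rightarrow> symbol) \<Rightarrow> config \<Rightarrow> config" where
  "step M T1 (q, i, j, T2) =
     (if q = final M then (q, i, j, T2)
      else case instr M q (T1 i) (T2 j) of
        (c, \<delta>1, \<delta>2, q') \<Rightarrow> (q', i + \<delta>1, j + \<delta>2, T2(j := c)))"

definition computes ::
    "machine \<Rightarrow> symbol word set \<Rightarrow> (symbol word \<Rightarrow> symbol word) \<Rightarrow> bool" where
  "computes M X F \<longleftrightarrow>
     (\<forall>x\<in>X. \<forall>m. \<exists>n i j.
        (step M (input_tape x) ^^ n) (initial_config M m) =
          (final M, i, j, \<lambda>l. if l = 0 then F x m else Blank))"

definition computable ::
    "symbol set \<Rightarrow> symbol word set \<Rightarrow> (symbol word \<Rightarrow> symbol word) \<Rightarrow> bool" where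
  "computable A X F \<longleftrightarrow>
     encoding A X \<and> F \<in> X \<rightarrow> X \<and> (\<exists>M. unary_machine A M \<and> computes M X F)"

end

theory Submission
  imports Defs "HOL-Analysis.Continuum_Not_Denumerable" "HOL-Library.Equipollence"
begin

text \<open>
  Multiplication by \<open>d\<close> looks hard to compute, but up to a permutation of \<open>X_R\<close> only its orbit
  structure matters, and there are just four possibilities. Reading decimals as real numbers
  (\<open>val\<close> is a bijection that turns \<open>\<cdot>\<^sub>R\<close> into the product of reals, \<open>val_mult\<close>), the shift by \<open>d\<close> is
  \<open>x \<mapsto> val d * x\<close>. If \<open>val d = 0\<close> it is constant. Otherwise it is a bijection that fixes \<open>0\<close>, and
  on the nonzero reals all points have the same period: \<open>1\<close> for \<open>val d = 1\<close>, \<open>2\<close> for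
  \<open>val d = -1\<close>, and all orbits are infinite in the remaining case, where no positive power of
  \<open>val d\<close> equals \<open>1\<close>. Period \<open>0\<close> stands for infinite orbits below.

  Two bijections of the same uncountable set all of whose points have the same period are conjugate
  (\<open>uniform_period_conjugate\<close>): every orbit is countable, so both maps have as many orbits as the
  set has points, and any bijection between the orbits can be followed along the orbits. So it
  suffices to exhibit, for each of the periods \<open>1\<close>, \<open>2\<close> and \<open>0\<close>, one computable bijection of \<open>X_R\<close>
  that fixes the word of zero and has that period everywhere else.

  These model maps are letter-to-letter finite-state transducers, and a unary machine computes every
  such transducer (\<open>computable_mealy\<close>): it runs the transducer along the first tape while counting
  the binary index on the second tape down to zero. The models copy the input up to and including the
  first nonzero digit and only act on the digits behind it. The word of zero has no such digit
  and is therefore fixed without ever having to be recognised, which no machine could do after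
  reading finitely many digits. Behind the leading digit arbitrary digits may be exchanged, as long
  as no infinite tail of nines is created or destroyed. Period \<open>1\<close> is the identity and period \<open>2\<close>
  exchanges \<open>2i\<close> with \<open>2i + 1\<close> in the next digit. Period \<open>0\<close> is an odometer in base nine that skips
  every digit \<open>9\<close>: a tail contains infinitely many digits other than \<open>9\<close>, so the odometer never
  returns to its initial position (\<open>odometer_aperiodic\<close>).
\<close>

section \<open>Conjugacy of maps with equal periods\<close>

lemma bij_betw_funpow_set:
  assumes "bij_betw f S S"
  shows "bij_betw (f ^^ k) S S"
proof (induction k)
  case 0
  show ?case by (simp add: bij_betw_def)
next
  case (Suc k)
  show ?case using bij_betw_trans[OF Suc assms] by (simp add: comp_def)
qed

text \<open>
  For an injective \<open>f\<close> these are the orbits under the integer powers of \<open>f\<close>; two nonnegative exponents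
  replace an integer one, which avoids the inverse map.
\<close>

definition same_orbit :: "('a \<Rightarrow> 'a) \<Rightarrow> 'a \<Rightarrow> 'a \<Rightarrow> bool" where
  "same_orbit f x y \<longleftrightarrow> (\<exists>i j. (f ^^ i) x = (f ^^ j) y)"

lemma same_orbit_refl: "same_orbit f x x"
  unfolding same_orbit_def by blast

lemma same_orbit_sym: "same_orbit f x y \<Longrightarrow> same_orbit f y x"
  unfolding same_orbit_def by metis

lemma same_orbit_trans:
  assumes "same_orbit f x y" "same_orbit f y z"
  shows "same_orbit f x z"
proof -
  obtain i j k l where a: "(f ^^ i) x = (f ^^ j) y" and b: "(f ^^ k) y = (f ^^ l) z"
    using assms unfolding same_orbit_def by blast
  have "(f ^^ (k + i)) x = (f ^^ (j + k)) y"
    by (simp add: funpow_add a flip: add.commute[of k j])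
  also have "\<dots> = (f ^^ (j + l)) z"
    by (simp add: funpow_add b)
  finally show ?thesis unfolding same_orbit_def by blast
qed

definition transversal :: "('a \<Rightarrow> 'a) \<Rightarrow> 'a set \<Rightarrow> 'a set \<Rightarrow> bool" where
  "transversal f S A \<longleftrightarrow>
     A \<subseteq> S \<and> (\<forall>x\<in>S. \<exists>a\<in>A. same_orbit f x a) \<and>
     (\<forall>a\<in>A. \<forall>b\<in>A. same_orbit f a b \<longrightarrow> a = b)"

lemma transversal_exists: "\<exists>A. transversal f S A"
proof -
  define rep where "rep x = (SOME y. y \<in> S \<and> same_orbit f x y)" for x
  have rep: "rep x \<in> S \<and> same_orbit f x (rep x)" if "x \<in> S" for x
    unfolding rep_def by (rule someI[of _ x]) (simp add: that same_orbit_refl)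
  have eq: "rep x = rep y" if "same_orbit f x y" for x y
  proof -
    have "same_orbit f x z \<longleftrightarrow> same_orbit f y z" for z
      using that same_orbit_sym same_orbit_trans by metis
    then show ?thesis unfolding rep_def by simp
  qed
  have "transversal f S (rep ` S)"
    unfolding transversal_def
  proof (intro conjI ballI impI)
    show "rep ` S \<subseteq> S" using rep by auto
  next
    fix x assume "x \<in> S"
    then show "\<exists>a\<in>rep ` S. same_orbit f x a" using rep by blast
  next
    fix a b assume "a \<in> rep ` S" "b \<in> rep ` S" and ab: "same_orbit f a b"
    then obtain x y where "x \<in> S" "a = rep x" "y \<in> S" "b = rep y" by auto
    moreover from this have "same_orbit f x y"
      using rep ab same_orbit_sym same_orbit_trans by metis
    ultimately show "a = b" using eq by simp
  qed
  then show ?thesis by blast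
qed

text \<open>
  A point is determined by its representative \<open>a\<close> and the two exponents that relate it to \<open>a\<close>, so \<open>S\<close>
  embeds into \<open>A \<times> \<nat> \<times> \<nat>\<close>. As \<open>S\<close> is uncountable, \<open>A\<close> is infinite and absorbs the countable factor.
\<close>

lemma transversal_eqpoll:
  assumes f: "bij_betw f S S" and "uncountable S" and A: "transversal f S A"
  shows "A \<approx> S"
proof -
  include cardinal_syntax
  have "\<exists>t. fst t \<in> A \<and> (f ^^ fst (snd t)) x = (f ^^ snd (snd t)) (fst t)" if "x \<in> S" for x
    using A that unfolding transversal_def same_orbit_def by simp blast
  then obtain c where c: "\<And>x. x \<in> S \<Longrightarrow> fst (c x) \<in> A \<and>
      (f ^^ fst (snd (c x))) x = (f ^^ snd (snd (c x))) (fst (c x))"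
    by metis
  have "inj_on c S"
  proof (rule inj_onI)
    fix x y assume xy: "x \<in> S" "y \<in> S" "c x = c y"
    then have "(f ^^ fst (snd (c x))) x = (f ^^ fst (snd (c x))) y"
      using c[of x] c[of y] by simp
    then show "x = y"
      using xy bij_betw_funpow_set[OF f] by (meson bij_betw_imp_inj_on inj_on_eq_iff)
  qed
  moreover have "c ` S \<subseteq> A \<times> (UNIV :: (nat \<times> nat) set)"
    using c by (simp add: image_subset_iff mem_Times_iff)
  ultimately have S: "S \<lesssim> A \<times> (UNIV :: (nat \<times> nat) set)"
    unfolding lepoll_def by blast
  have "infinite A"
  proof
    assume "finite A"
    then have "countable (A \<times> (UNIV :: (nat \<times> nat) set))"
      by (simp add: countable_finite)
    then show False using S assms(2) countable_lepoll by blast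
  qed
  then have "(UNIV :: nat set) \<lesssim> A"
    by (simp add: infinite_le_lepoll)
  moreover have "(UNIV :: (nat \<times> nat) set) \<lesssim> (UNIV :: nat set)"
    unfolding lepoll_def by (intro exI[of _ to_nat]) simp
  ultimately have "(UNIV :: (nat \<times> nat) set) \<lesssim> A"
    using lepoll_trans by blast
  then have "|UNIV :: (nat \<times> nat) set| \<le>o |A|"
    by (simp add: lepoll_def card_of_ordLeq)
  then have "|A \<times> (UNIV :: (nat \<times> nat) set)| =o |A|"
    using card_of_Times_infinite[OF \<open>infinite A\<close>, of "UNIV :: (nat \<times> nat) set"] by simp
  then have "A \<times> (UNIV :: (nat \<times> nat) set) \<approx> A"
    by (simp add: eqpoll_iff_card_of_ordIso)
  then have "S \<lesssim> A" using S lepoll_trans2 by blast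
  moreover have "A \<lesssim> S" using A by (simp add: transversal_def subset_imp_lepoll)
  ultimately show ?thesis by (simp add: lepoll_antisym)
qed

text \<open>
  Period \<open>0\<close> expresses that all orbits are infinite, since \<open>0\<close> divides only \<open>0\<close>.
\<close>

definition uniform_period :: "('a \<Rightarrow> 'a) \<Rightarrow> 'a set \<Rightarrow> nat \<Rightarrow> bool" where
  "uniform_period f S n \<longleftrightarrow> bij_betw f S S \<and> (\<forall>x\<in>S. \<forall>k. (f ^^ k) x = x \<longleftrightarrow> n dvd k)"

lemma uniform_period_in:
  assumes "uniform_period f S n" "x \<in> S"
  shows "(f ^^ k) x \<in> S"
  using assms bij_betw_funpow_set[of f S k] bij_betwE unfolding uniform_period_def by blast

lemma uniform_period_inj:
  assumes "uniform_period f S n" "x \<in> S" "y \<in> S" "(f ^^ k) x = (f ^^ k) y"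
  shows "x = y"
  using assms bij_betw_funpow_set[of f S k] unfolding uniform_period_def
  by (meson bij_betw_imp_inj_on inj_on_eq_iff)

lemma funpow_eq_iff_uniform_period:
  assumes f: "uniform_period f S n" and x: "x \<in> S"
  shows "(f ^^ i) x = (f ^^ j) x \<longleftrightarrow> int n dvd int i - int j"
proof -
  have *: "(f ^^ (j + k)) x = (f ^^ j) x \<longleftrightarrow> n dvd k" for j k
  proof -
    have "(f ^^ (j + k)) x = (f ^^ j) x \<longleftrightarrow> (f ^^ k) x = x"
      using uniform_period_inj[OF f uniform_period_in[OF f x] x, of j k]
      by (auto simp: funpow_add)
    then show ?thesis using f x by (simp add: uniform_period_def)
  qed
  show ?thesis
  proof (cases "j \<le> i")
    case True
    then obtain k where k: "i = j + k" using le_Suc_ex by blast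
    show ?thesis using *[of j k] by (simp add: k)
  next
    case False
    then obtain k where k: "j = i + k" using le_Suc_ex nat_le_linear by blast
    show ?thesis using *[of i k] by (auto simp: k)
  qed
qed

text \<open>
  Here \<open>y\<close> is the point that lies relative to \<open>h a\<close> as \<open>x\<close> lies relative to \<open>a\<close>. The exponents that
  relate \<open>x\<close> to \<open>a\<close> are not unique, but their difference \<open>i - j\<close> is determined modulo the period of \<open>f\<close>,
  which is also the period of \<open>g\<close>.
\<close>

lemma orbit_matching_unique:
  assumes f: "uniform_period f S n" and g: "uniform_period g S n"
    and A: "transversal f S A" and h: "h \<in> A \<rightarrow> S"
    and x: "x \<in> S"
  shows "\<exists>!y. y \<in> S \<and> (\<exists>a\<in>A. \<exists>i j. (f ^^ i) x = (f ^^ j) a \<and> (g ^^ i) y = (g ^^ j) (h a))"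
proof -
  obtain a i j where a: "a \<in> A" "(f ^^ i) x = (f ^^ j) a"
    using A x unfolding transversal_def same_orbit_def by blast
  then have aS: "a \<in> S" "h a \<in> S" using A h by (auto simp: transversal_def)
  have "(g ^^ i) ` S = S"
    using g bij_betw_funpow_set bij_betw_imp_surj_on unfolding uniform_period_def by blast
  then obtain y where y: "y \<in> S" "(g ^^ i) y = (g ^^ j) (h a)"
    using uniform_period_in[OF g aS(2), of j] by (metis imageE)
  show ?thesis
  proof (rule ex1I[of _ y])
    show "y \<in> S \<and> (\<exists>a\<in>A. \<exists>i j. (f ^^ i) x = (f ^^ j) a \<and> (g ^^ i) y = (g ^^ j) (h a))"
      using a y by blast
  next
    fix y'
    assume "y' \<in> S \<and> (\<exists>a\<in>A. \<exists>i j. (f ^^ i) x = (f ^^ j) a \<and> (g ^^ i) y' = (g ^^ j) (h a))"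
    then obtain a' i' j' where y': "y' \<in> S" "a' \<in> A" "(f ^^ i') x = (f ^^ j') a'"
      "(g ^^ i') y' = (g ^^ j') (h a')" by blast
    have "same_orbit f a x" "same_orbit f x a'"
      using a(2) y'(3) unfolding same_orbit_def by metis+
    then have "same_orbit f a a'" by (rule same_orbit_trans)
    then have [simp]: "a' = a"
      using A a(1) y'(2) unfolding transversal_def by blast
    \<comment> \<open>Comparing two descriptions of \<open>x\<close> gives two powers of \<open>f\<close> that agree at \<open>a\<close>, hence
      two powers of \<open>g\<close> that agree at \<open>h a\<close>.\<close>
    have "(f ^^ (i' + j)) a = (f ^^ (i' + i)) x"
      by (simp add: funpow_add a(2))
    also have "\<dots> = (f ^^ (i + j')) a"
      using y'(3) by (simp add: add.commute[of i' i] funpow_add)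
    finally have "(g ^^ (i' + j)) (h a) = (g ^^ (i + j')) (h a)"
      using aS by (simp add: funpow_eq_iff_uniform_period[OF f] funpow_eq_iff_uniform_period[OF g])
    moreover have "(g ^^ (i' + i)) y = (g ^^ (i' + j)) (h a)"
      by (simp add: funpow_add y(2))
    moreover have "(g ^^ (i' + i)) y' = (g ^^ (i + j')) (h a)"
      using y'(4) by (simp add: add.commute[of i' i] funpow_add)
    ultimately have "(g ^^ (i' + i)) y = (g ^^ (i' + i)) y'"
      by simp
    then show "y' = y"
      using uniform_period_inj[OF g] y(1) y'(1) by metis
  qed
qed

text \<open>
  The conjugating map sends representatives to representatives by a bijection \<open>h\<close> of the two
  transversals, which are equipotent because both are equipotent to \<open>S\<close>, and extends \<open>h\<close> along the
  orbits. Its graph \<open>P\<close> is symmetric in the two maps, so the lemma on unique matching yields both that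
  \<open>P\<close> is a function and that this function is bijective.
\<close>

theorem uniform_period_conjugate:
  assumes f: "uniform_period f S n" and g: "uniform_period g S n" and S: "uncountable S"
  shows "\<exists>\<pi>. bij_betw \<pi> S S \<and> (\<forall>x\<in>S. \<pi> (f x) = g (\<pi> x))"
proof -
  obtain A where A: "transversal f S A" using transversal_exists by blast
  obtain B where B: "transversal g S B" using transversal_exists by blast
  have "A \<approx> B"
    using transversal_eqpoll[OF _ S A] transversal_eqpoll[OF _ S B] f g
      eqpoll_trans eqpoll_sym unfolding uniform_period_def by blast
  then obtain h where h: "bij_betw h A B" unfolding eqpoll_def by blast
  define P where "P x y \<longleftrightarrow>
      (\<exists>a\<in>A. \<exists>i j. (f ^^ i) x = (f ^^ j) a \<and> (g ^^ i) y = (g ^^ j) (h a))" for x y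
  have P': "P x y \<longleftrightarrow> (\<exists>b\<in>B. \<exists>i j. (g ^^ i) y = (g ^^ j) b \<and>
      (f ^^ i) x = (f ^^ j) (inv_into A h b))" for x y
    unfolding P_def bij_betw_imp_surj_on[OF h, symmetric] bex_simps(7)
    by (intro bex_cong refl ex_cong1) (auto simp: bij_betw_inv_into_left[OF h])
  have AS: "A \<subseteq> S" and BS: "B \<subseteq> S" using A B by (auto simp: transversal_def)
  have "h \<in> A \<rightarrow> S" using bij_betwE[OF h] BS by auto
  then have ex1: "\<exists>!y. y \<in> S \<and> P x y" if "x \<in> S" for x
    using orbit_matching_unique[OF f g A _ that] unfolding P_def by blast
  have "inv_into A h \<in> B \<rightarrow> S"
    using bij_betwE[OF bij_betw_inv_into[OF h]] AS by auto
  then have ex2: "\<exists>!x. x \<in> S \<and> P x y" if "y \<in> S" for y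
    using orbit_matching_unique[OF g f B _ that] unfolding P' by blast
  have comm: "P (f x) (g y)" if xy: "P x y" for x y
  proof -
    obtain a i j where a: "a \<in> A" and "(f ^^ i) x = (f ^^ j) a" "(g ^^ i) y = (g ^^ j) (h a)"
      using xy unfolding P_def by blast
    then have "(f ^^ i) (f x) = (f ^^ Suc j) a" "(g ^^ i) (g y) = (g ^^ Suc j) (h a)"
      by (simp_all add: funpow_swap1[symmetric])
    then show ?thesis using a unfolding P_def by blast
  qed
  define \<pi> where "\<pi> x = (THE y. y \<in> S \<and> P x y)" for x
  have \<pi>: "\<pi> x \<in> S \<and> P x (\<pi> x)" if "x \<in> S" for x
    unfolding \<pi>_def by (rule theI'[OF ex1[OF that]])
  have \<pi>_eq: "\<pi> x = y" if "x \<in> S" "y \<in> S" "P x y" for x y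
    using ex1[OF that(1)] \<pi>[OF that(1)] that by blast
  have fS: "f x \<in> S" and gS: "g x \<in> S" if "x \<in> S" for x
    using f g that bij_betwE unfolding uniform_period_def by blast+
  have "inj_on \<pi> S"
  proof (rule inj_onI)
    fix x x' assume "x \<in> S" "x' \<in> S" "\<pi> x = \<pi> x'"
    then show "x = x'" using \<pi>[of x] \<pi>[of x'] ex2[of "\<pi> x"] by auto
  qed
  moreover have "\<pi> ` S = S"
  proof
    show "\<pi> ` S \<subseteq> S" using \<pi> by blast
    show "S \<subseteq> \<pi> ` S"
    proof
      fix y assume "y \<in> S"
      then obtain x where "x \<in> S" "P x y" using ex2 by blast
      then show "y \<in> \<pi> ` S" using \<pi>_eq \<open>y \<in> S\<close> by blast
    qed
  qed
  moreover have "\<pi> (f x) = g (\<pi> x)" if "x \<in> S" for x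
    using \<pi>_eq[OF fS[OF that] gS comm] \<pi>[OF that] by simp
  ultimately show ?thesis by (auto simp: bij_betw_def)
qed

section \<open>Finite-state transducers on infinite words\<close>

primrec mealy_state :: "(nat \<Rightarrow> 'a \<Rightarrow> nat) \<Rightarrow> nat \<Rightarrow> 'a word \<Rightarrow> nat \<Rightarrow> nat" where
  "mealy_state \<delta> q w 0 = q"
| "mealy_state \<delta> q w (Suc i) = \<delta> (mealy_state \<delta> q w i) (w i)"

definition mealy ::
    "(nat \<Rightarrow> 'a \<Rightarrow> nat) \<Rightarrow> (nat \<Rightarrow> 'a \<Rightarrow> 'b) \<Rightarrow> nat \<Rightarrow> 'a word \<Rightarrow> 'b word" where
  "mealy \<delta> out q w = (\<lambda>i. out (mealy_state \<delta> q w i) (w i))"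

lemma mealy_state_build:
  "mealy_state \<delta> q (a ## w) (Suc i) = mealy_state \<delta> (\<delta> q a) w i"
  by (induction i) simp_all

lemma mealy_build: "mealy \<delta> out q (a ## w) = out q a ## mealy \<delta> out (\<delta> q a) w"
proof
  fix i
  show "mealy \<delta> out q (a ## w) i = (out q a ## mealy \<delta> out (\<delta> q a) w) i"
    by (cases i) (simp_all add: mealy_def mealy_state_build del: mealy_state.simps(2))
qed

text \<open>
  When each state permutes the letters, the transducer is inverted by the transducer that decodes the
  letter just read before it changes state, so both pass through the same states.
\<close>

lemma bij_mealy:
  assumes out: "\<And>q. bij (out q)"
  shows "bij (mealy \<delta> out q)"
proof -
  define \<delta>' where "\<delta>' q b = \<delta> q (inv (out q) b)" for q b
  let ?f = "mealy \<delta> out q" and ?g = "mealy \<delta>' (\<lambda>q. inv (out q)) q"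
  have inv: "inv (out q) (out q a) = a" "out q (inv (out q) b) = b" for q a b
    using bij_is_inj[OF out] bij_is_surj[OF out] by (simp_all add: surj_f_inv_f)
  have "mealy_state \<delta>' q (?f w) i = mealy_state \<delta> q w i" for w i
    by (induction i) (simp_all add: mealy_def \<delta>'_def inv)
  then have "?g \<circ> ?f = id"
    by (simp add: fun_eq_iff mealy_def inv)
  moreover have "mealy_state \<delta> q (?g w) i = mealy_state \<delta>' q w i" for w i
    by (induction i) (simp_all add: mealy_def \<delta>'_def inv)
  then have "?f \<circ> ?g = id"
    by (simp add: fun_eq_iff mealy_def inv)
  ultimately show ?thesis by (rule o_bij)
qed

text \<open>
  The transducer reproduces \<open>s\<close> on its way from state \<open>q\<close> to state \<open>q'\<close>.
\<close>

primrec copies ::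
    "(nat \<Rightarrow> 'a \<Rightarrow> nat) \<Rightarrow> (nat \<Rightarrow> 'a \<Rightarrow> 'a) \<Rightarrow> nat \<Rightarrow> 'a list \<Rightarrow> nat \<Rightarrow> bool" where
  "copies \<delta> out q [] q' \<longleftrightarrow> q = q'"
| "copies \<delta> out q (a # s) q' \<longleftrightarrow> out q a = a \<and> copies \<delta> out (\<delta> q a) s q'"

lemma copies_append:
  "copies \<delta> out q s r \<Longrightarrow> copies \<delta> out r t q' \<Longrightarrow> copies \<delta> out q (s @ t) q'"
  by (induction s arbitrary: q) simp_all

lemma copies_loop:
  "\<forall>a\<in>set s. \<delta> q a = q \<and> out q a = a \<Longrightarrow> copies \<delta> out q s q"
  by (induction s) simp_all

lemma mealy_copies:
  "copies \<delta> out q s q' \<Longrightarrow> mealy \<delta> out q (s \<frown> w) = s \<frown> mealy \<delta> out q' w"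
  by (induction s arbitrary: q) (simp_all add: mealy_build)

section \<open>Unary machines for finite-state transducers\<close>

definition bit_tape :: "nat list \<Rightarrow> int \<Rightarrow> symbol" where
  "bit_tape bs = (\<lambda>i. if 0 \<le> i \<and> nat i < length bs then Digit (bs ! nat i) else Blank)"

lemma index_tape_eq: "index_tape m = bit_tape (binary m)"
  by (simp add: index_tape_def bit_tape_def)

lemma bit_tape_nth: "j < length bs \<Longrightarrow> bit_tape bs (int j) = Digit (bs ! j)"
  by (simp add: bit_tape_def)

lemma bit_tape_end: "bit_tape bs (int (length bs)) = Blank"
  by (simp add: bit_tape_def)

lemma bit_tape_neg: "i < 0 \<Longrightarrow> bit_tape bs i = Blank"
  by (simp add: bit_tape_def)

lemma bit_tape_update:
  "j < length bs \<Longrightarrow> (bit_tape bs)(int j := Digit b) = bit_tape (bs[j := b])"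
  by (auto simp: bit_tape_def fun_eq_iff nth_list_update)

lemma bit_tape_erase: "(bit_tape (bs @ [b]))(int (length bs) := Blank) = bit_tape bs"
  by (auto simp: bit_tape_def fun_eq_iff nth_append)

lemma bit_tape_Nil_update: "(bit_tape [])(0 := c) = (\<lambda>l. if l = 0 then c else Blank)"
  by (auto simp: bit_tape_def fun_eq_iff)

primrec bits_value :: "nat list \<Rightarrow> nat" where
  "bits_value [] = 0"
| "bits_value (b # bs) = b + 2 * bits_value bs"

lemma bits_value_binary: "bits_value (binary n) = n"
proof (induction n rule: binary.induct)
  case (1 n)
  then show ?case by (subst binary.simps) auto
qed

lemma set_binary: "set (binary n) \<subseteq> {0, 1}"
proof (induction n rule: binary.induct)
  case (1 n)
  then show ?case by (subst binary.simps) auto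
qed

text \<open>
  The effect of borrowing: the lowest bit \<open>1\<close> becomes \<open>0\<close> and the zeros below it become ones.
\<close>

lemma bits_value_decrement:
  "bits_value (replicate j 0 @ 1 # bs) = Suc (bits_value (replicate j 1 @ 0 # bs))"
  by (induction j) auto

lemma bits_cases:
  assumes "set bs \<subseteq> {0, 1}"
  obtains "bs = replicate (length bs) 0" "bits_value bs = 0"
  | j cs where "bs = replicate j 0 @ 1 # cs" "set cs \<subseteq> {0, 1}"
proof -
  have "bs = replicate (length bs) 0 \<and> bits_value bs = 0 \<or>
        (\<exists>j cs. bs = replicate j 0 @ 1 # cs \<and> set cs \<subseteq> {0, 1})"
    using assms
  proof (induction bs)
    case (Cons b bs)
    show ?case
    proof (cases "b = 1")
      case True
      then have "b # bs = replicate 0 0 @ 1 # bs" by simp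
      then show ?thesis using Cons.prems by (metis set_subset_Cons subset_trans)
    next
      case False
      then have [simp]: "b = 0" using Cons.prems by simp
      from Cons.IH Cons.prems consider "bs = replicate (length bs) 0 \<and> bits_value bs = 0"
        | j cs where "bs = replicate j 0 @ 1 # cs" "set cs \<subseteq> {0, 1}" by auto
      then show ?thesis
      proof cases
        case 1
        then show ?thesis by simp
      next
        case (2 j cs)
        then have "b # bs = replicate (Suc j) 0 @ 1 # cs" by simp
        then show ?thesis using 2(2) by metis
      qed
    qed
  qed simp
  then show thesis using that by blast
qed

text \<open>
  The control state of the machine in phase \<open>ph\<close> while the simulated transducer is in state \<open>q\<close>;
  control state \<open>0\<close> is left for termination.
\<close>

definition ctrl :: "nat \<Rightarrow> nat \<Rightarrow> nat" where
  "ctrl q ph = Suc (4 * q + ph)"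

text \<open>
  Phase \<open>0\<close> subtracts one from the binary counter, moving right and turning zeros into ones until a
  bit \<open>1\<close> is found and cleared. Then phase \<open>1\<close> returns to the blank cell before the counter, feeds
  the letter scanned on the first tape to the transducer and goes on to the next letter. If phase
  \<open>0\<close> finds no bit \<open>1\<close>, the counter was zero and the current letter is the one in question: phase
  \<open>2\<close> erases the counter from right to left and phase \<open>3\<close> writes the output letter into cell \<open>0\<close>.
  The counter keeps its length, so leading zeros do occur. The clause for letters outside
  \<open>A\<close> only keeps the table within the alphabet.
\<close>

definition mealy_instr ::
    "symbol set \<Rightarrow> (nat \<Rightarrow> symbol \<Rightarrow> nat) \<Rightarrow> (nat \<Rightarrow> symbol \<Rightarrow> symbol) \<Rightarrow>
     nat \<Rightarrow> symbol \<Rightarrow> symbol \<Rightarrow> symbol \<times> int \<times> int \<times> nat" where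
  "mealy_instr A \<delta> out s a b = (let q = (s - 1) div 4; ph = (s - 1) mod 4 in
     if a \<notin> A then (Blank, 0, 0, 0)
     else if ph = 0 then
       (if b = Digit 0 then (Digit 1, 0, 1, ctrl q 0)
        else if b = Blank then (Blank, 0, -1, ctrl q 2)
        else (Digit 0, 0, -1, ctrl q 1))
     else if ph = 1 then
       (if b = Blank then (Blank, 1, 1, ctrl (\<delta> q a) 0) else (b, 0, -1, ctrl q 1))
     else if ph = 2 then
       (if b = Blank then (Blank, 0, 1, ctrl q 3) else (Blank, 0, -1, ctrl q 2))
     else (out q a, 0, 0, 0))"

definition mealy_machine ::
    "symbol set \<Rightarrow> nat set \<Rightarrow> (nat \<Rightarrow> symbol \<Rightarrow> nat) \<Rightarrow> (nat \<Rightarrow> symbol \<Rightarrow> symbol) \<Rightarrow> nat \<Rightarrow> machine"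
  where
  "mealy_machine A Q \<delta> out q0 =
     \<lparr>states = insert 0 {ctrl q ph | q ph. q \<in> Q \<and> ph < 4}, start = ctrl q0 0, final = 0,
      alphabet = A \<union> {Digit 0, Digit 1, Blank}, instr = mealy_instr A \<delta> out\<rparr>"

definition reaches :: "machine \<Rightarrow> (int \<Rightarrow> symbol) \<Rightarrow> config \<Rightarrow> config \<Rightarrow> bool" where
  "reaches M T c c' \<longleftrightarrow> (\<exists>n. (step M T ^^ n) c = c')"

lemma reaches_refl: "reaches M T c c"
  unfolding reaches_def by (intro exI[of _ 0]) simp

lemma reaches_step: "step M T c = c' \<Longrightarrow> reaches M T c' c'' \<Longrightarrow> reaches M T c c''"
  unfolding reaches_def
  by (metis comp_apply funpow_Suc_right)

lemma reaches_trans: "reaches M T c c' \<Longrightarrow> reaches M T c' c'' \<Longrightarrow> reaches M T c c''"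
  unfolding reaches_def
  by (metis comp_apply funpow_add)

lemma unary_mealy_machine:
  assumes "finite A" "Blank \<notin> A" "finite Q" "q0 \<in> Q"
    and \<delta>: "\<And>q a. q \<in> Q \<Longrightarrow> \<delta> q a \<in> Q"
    and out: "\<And>q a. q \<in> Q \<Longrightarrow> a \<in> A \<Longrightarrow> out q a \<in> A"
  shows "unary_machine A (mealy_machine A Q \<delta> out q0)"
proof -
  define C where "C = {ctrl q ph | q ph. q \<in> Q \<and> ph < 4}"
  have "C = (\<lambda>(q, ph). ctrl q ph) ` (Q \<times> {..<4})"
    by (auto simp: C_def)
  then have fin: "finite C"
    using assms by simp
  have C: "ctrl q ph \<in> C" if "q \<in> Q" "ph < 4" for q ph
    using that by (auto simp: C_def)
  have "mealy_instr A \<delta> out s a b \<in>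
      (A \<union> {Digit 0, Digit 1, Blank}) \<times> {-1, 0, 1} \<times> {-1, 0, 1} \<times> insert 0 C"
    if s: "s \<in> C" and b: "b \<in> A \<union> {Digit 0, Digit 1, Blank}" for s a b
  proof -
    obtain q ph where s: "s = ctrl q ph" and q: "q \<in> Q" and ph: "ph < 4"
      using s by (auto simp: C_def)
    have "(s - 1) div 4 = q" "(s - 1) mod 4 = ph"
      using ph by (simp_all add: s ctrl_def)
    then show ?thesis
      using q b \<delta>[OF q, of a] out[OF q, of a] by (auto simp: mealy_instr_def Let_def C)
  qed
  then show ?thesis
    using assms fin C
    unfolding unary_machine_def mealy_machine_def C_def[symmetric]
    by (auto simp del: One_nat_def)
qed

lemma step_mealy_machine:
  assumes "ph < 4" "T i \<in> A"
  shows "step (mealy_machine A Q \<delta> out q0) T (ctrl q ph, i, j, T2) =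
    (if ph = 0 then
       (if T2 j = Digit 0 then (ctrl q 0, i, j + 1, T2(j := Digit 1))
        else if T2 j = Blank then (ctrl q 2, i, j - 1, T2(j := Blank))
        else (ctrl q 1, i, j - 1, T2(j := Digit 0)))
     else if ph = 1 then
       (if T2 j = Blank then (ctrl (\<delta> q (T i)) 0, i + 1, j + 1, T2(j := Blank))
        else (ctrl q 1, i, j - 1, T2(j := T2 j)))
     else if ph = 2 then
       (if T2 j = Blank then (ctrl q 3, i, j + 1, T2(j := Blank))
        else (ctrl q 2, i, j - 1, T2(j := Blank)))
     else (0, i, j, T2(j := out q (T i))))"
  using assms by (simp add: mealy_machine_def mealy_instr_def ctrl_def Let_def)

declare step.simps [simp del]

context
  fixes A Q \<delta> out q0 M and q :: nat and T :: "int \<Rightarrow> symbol" and i :: int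
  defines "M \<equiv> mealy_machine A Q \<delta> out q0"
  assumes T: "T i \<in> A"
begin

lemma reaches_borrow:
  "reaches M T (ctrl q 0, i, int k, bit_tape (replicate k 1 @ replicate j 0 @ cs))
     (ctrl q 0, i, int (k + j), bit_tape (replicate (k + j) 1 @ cs))"
proof (induction j arbitrary: k)
  case 0
  show ?case by (simp add: reaches_refl)
next
  case (Suc j)
  let ?bs = "replicate k 1 @ replicate (Suc j) 0 @ cs"
  have upd: "?bs[k := 1] = replicate (Suc k) 1 @ replicate j 0 @ cs"
    by (simp add: list_update_append replicate_append_same flip: replicate_Suc)
       (simp add: replicate_app_Cons_same)
  have "bit_tape ?bs (int k) = Digit 0"
    by (subst bit_tape_nth) (simp_all add: nth_append)
  then have "step M T (ctrl q 0, i, int k, bit_tape ?bs) =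
      (ctrl q 0, i, int (Suc k), bit_tape (replicate (Suc k) 1 @ replicate j 0 @ cs))"
    unfolding M_def using T bit_tape_update[of k ?bs 1, unfolded upd]
    by (simp add: step_mealy_machine add.commute[of _ 1])
  then show ?case
    using Suc[of "Suc k"] by (simp add: reaches_step)
qed

lemma reaches_return:
  "j \<le> length bs \<Longrightarrow> reaches M T (ctrl q 1, i, int j - 1, bit_tape bs)
     (ctrl (\<delta> q (T i)) 0, i + 1, 0, bit_tape bs)"
proof (induction j)
  case 0
  show ?case
    by (rule reaches_step[OF _ reaches_refl])
       (simp add: M_def T step_mealy_machine bit_tape_neg fun_upd_idem)
next
  case (Suc j)
  then have "step M T (ctrl q 1, i, int (Suc j) - 1, bit_tape bs) =
      (ctrl q 1, i, int j - 1, bit_tape bs)"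
    by (simp add: M_def T step_mealy_machine bit_tape_nth fun_upd_idem)
  then show ?case using Suc by (simp add: reaches_step)
qed

lemma reaches_erase:
  "reaches M T (ctrl q 2, i, int (length bs) - 1, bit_tape bs) (ctrl q 3, i, 0, bit_tape [])"
proof (induction bs rule: rev_induct)
  case Nil
  show ?case
    by (rule reaches_step[OF _ reaches_refl])
       (simp add: M_def T step_mealy_machine bit_tape_neg fun_upd_idem)
next
  case (snoc b bs)
  have "bit_tape (bs @ [b]) (int (length bs)) = Digit b"
    by (subst bit_tape_nth) simp_all
  then have "step M T (ctrl q 2, i, int (length (bs @ [b])) - 1, bit_tape (bs @ [b])) =
      (ctrl q 2, i, int (length bs) - 1, bit_tape bs)"
    by (simp add: M_def T step_mealy_machine bit_tape_erase)
  then show ?case using snoc by (rule reaches_step)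
qed

lemma reaches_decrement:
  "reaches M T (ctrl q 0, i, 0, bit_tape (replicate j 0 @ 1 # cs))
     (ctrl (\<delta> q (T i)) 0, i + 1, 0, bit_tape (replicate j 1 @ 0 # cs))"
proof -
  let ?bs = "replicate j 1 @ 1 # cs"
  have "reaches M T (ctrl q 0, i, 0, bit_tape (replicate j 0 @ 1 # cs))
     (ctrl q 0, i, int j, bit_tape ?bs)"
    using reaches_borrow[of 0 j "1 # cs"] by simp
  moreover have "step M T (ctrl q 0, i, int j, bit_tape ?bs) =
     (ctrl q 1, i, int j - 1, bit_tape (replicate j 1 @ 0 # cs))"
  proof -
    have "bit_tape ?bs (int j) = Digit 1"
      by (subst bit_tape_nth) (simp_all add: nth_append)
    then show ?thesis
      using bit_tape_update[of j ?bs 0]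
      by (simp add: M_def T step_mealy_machine list_update_append)
  qed
  moreover have "reaches M T (ctrl q 1, i, int j - 1, bit_tape (replicate j 1 @ 0 # cs))
     (ctrl (\<delta> q (T i)) 0, i + 1, 0, bit_tape (replicate j 1 @ 0 # cs))"
    by (rule reaches_return) simp
  ultimately show ?thesis using reaches_step reaches_trans by blast
qed

lemma reaches_output:
  "reaches M T (ctrl q 0, i, 0, bit_tape (replicate L 0))
     (0, i, 0, \<lambda>l. if l = 0 then out q (T i) else Blank)"
proof -
  let ?bs = "replicate L (1 :: nat)"
  have "reaches M T (ctrl q 0, i, 0, bit_tape (replicate L 0)) (ctrl q 0, i, int L, bit_tape ?bs)"
    using reaches_borrow[of 0 L "[]"] by simp
  moreover have "reaches M T (ctrl q 0, i, int L, bit_tape ?bs)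
      (ctrl q 2, i, int (length ?bs) - 1, bit_tape ?bs)"
    using bit_tape_end[of ?bs]
    by (intro reaches_step[OF _ reaches_refl])
       (simp add: M_def T step_mealy_machine fun_upd_idem)
  moreover note reaches_erase[of ?bs]
  moreover have "reaches M T (ctrl q 3, i, 0, bit_tape [])
      (0, i, 0, \<lambda>l. if l = 0 then out q (T i) else Blank)"
    by (intro reaches_step[OF _ reaches_refl])
       (simp add: M_def T step_mealy_machine bit_tape_Nil_update)
  ultimately show ?thesis
    by (blast intro: reaches_trans)
qed

end

text \<open>
  Induction on the value of the counter: each decrement advances the first head and the state of the
  transducer by one letter, so the sum of the position and the counter is invariant.
\<close>

lemma reaches_mealy_output:
  assumes "range w \<subseteq> A" "set bs \<subseteq> {0, 1}"
  shows "reaches (mealy_machine A Q \<delta> out q0) (input_tape w)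
     (ctrl (mealy_state \<delta> q w i) 0, int i, 0, bit_tape bs)
     (0, int (i + bits_value bs), 0,
       \<lambda>l. if l = 0 then mealy \<delta> out q w (i + bits_value bs) else Blank)"
  using assms(2)
proof (induction "bits_value bs" arbitrary: i bs)
  case 0
  have "bs = replicate (length bs) 0"
    using 0 bits_value_decrement by (cases rule: bits_cases[OF 0(2)]) auto
  moreover have "input_tape w (int i) \<in> A" "input_tape w (int i) = w i"
    using assms(1) by (auto simp: input_tape_def)
  ultimately show ?case
    using reaches_output[of "input_tape w" "int i" A Q \<delta> out q0 "mealy_state \<delta> q w i" "length bs"]
      0(1) by (simp add: mealy_def cong: if_cong)
next
  case (Suc m)
  obtain j cs where bs: "bs = replicate j 0 @ 1 # cs" "set cs \<subseteq> {0, 1}"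
    using Suc.hyps(2) by (cases rule: bits_cases[OF Suc.prems]) auto
  let ?bs = "replicate j 1 @ 0 # cs"
  have m: "bits_value bs = Suc (bits_value ?bs)" "m = bits_value ?bs"
    using bs Suc.hyps(2) bits_value_decrement[of j cs] by simp_all
  have "input_tape w (int i) \<in> A" "input_tape w (int i) = w i"
    using assms(1) by (auto simp: input_tape_def)
  then have first: "reaches (mealy_machine A Q \<delta> out q0) (input_tape w)
     (ctrl (mealy_state \<delta> q w i) 0, int i, 0, bit_tape bs)
     (ctrl (mealy_state \<delta> q w (Suc i)) 0, int (Suc i), 0, bit_tape ?bs)"
    using reaches_decrement[of "input_tape w" "int i" A Q \<delta> out q0 "mealy_state \<delta> q w i" j cs]
    by (simp add: bs add.commute[of 1])
  have "set ?bs \<subseteq> {0, 1}" using bs by auto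
  moreover have "Suc i + bits_value ?bs = i + bits_value bs" using m(1) by simp
  ultimately show ?case
    using reaches_trans[OF first Suc.hyps(1)[OF m(2)]] by (simp only: simp_thms)
qed

theorem computable_mealy:
  assumes "encoding A X" "Blank \<notin> A" "mealy \<delta> out q0 \<in> X \<rightarrow> X" "finite Q" "q0 \<in> Q"
    and "\<And>q a. q \<in> Q \<Longrightarrow> \<delta> q a \<in> Q"
    and "\<And>q a. q \<in> Q \<Longrightarrow> a \<in> A \<Longrightarrow> out q a \<in> A"
  shows "computable A X (mealy \<delta> out q0)"
proof -
  let ?M = "mealy_machine A Q \<delta> out q0"
  have "unary_machine A ?M"
    using assms by (intro unary_mealy_machine) (auto simp: encoding_def)
  moreover have "computes ?M X (mealy \<delta> out q0)"
    unfolding computes_def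
  proof (intro ballI allI)
    fix w m assume "w \<in> X"
    then have "range w \<subseteq> A" using assms(1) by (simp add: encoding_def)
    from reaches_mealy_output[OF this set_binary, of Q \<delta> out q0 q0 0 m]
    have "reaches ?M (input_tape w) (initial_config ?M m)
        (final ?M, int m, 0, \<lambda>l. if l = 0 then mealy \<delta> out q0 w m else Blank)"
      by (simp add: initial_config_def index_tape_eq bits_value_binary mealy_machine_def
          cong: if_cong)
    then show "\<exists>n i j. (step ?M (input_tape w) ^^ n) (initial_config ?M m) =
        (final ?M, i, j, \<lambda>l. if l = 0 then mealy \<delta> out q0 w m else Blank)"
      unfolding reaches_def by blast
  qed
  ultimately show ?thesis using assms(1,3) unfolding computable_def by blast
qed

section \<open>Decimals as real numbers\<close>

text \<open>
  The truncations of a decimal at every position, without the sign. Positions above the order are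
  included and give the empty sum, so the recursion over positions holds throughout.
\<close>

definition digit_sum :: "decimal \<Rightarrow> int \<Rightarrow> real" where
  "digit_sum d n = (\<Sum>j = n..int (ord d). real (digit d j) * 10 powi j)"

definition sgn_dec :: "decimal \<Rightarrow> real" where
  "sgn_dec d = (if neg d then - 1 else 1)"

definition abs_val :: "decimal \<Rightarrow> real" where
  "abs_val d = lim (\<lambda>m. digit_sum d (- int m))"

definition val :: "decimal \<Rightarrow> real" where
  "val d = sgn_dec d * abs_val d"

lemma is_decimal_Rep: "is_decimal (neg d) (ord d) (digit d)"
  using Rep_decimal[of d] by (simp add: neg_def ord_def digit_def case_prod_beta)

lemma digit_le_9: "digit d n \<le> 9"
  and digit_above_ord: "n > int (ord d) \<Longrightarrow> digit d n = 0"
  and digit_ord: "digit d (int (ord d)) = 0 \<Longrightarrow> ord d = 0"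
  and no_tail_9: "\<exists>m\<le>n. digit d m \<noteq> 9"
  and not_minus_zero: "neg d \<Longrightarrow> \<exists>n. digit d n \<noteq> 0"
proof -
  note D = is_decimal_Rep[of d, unfolded is_decimal_def]
  show "digit d n \<le> 9" "n > int (ord d) \<Longrightarrow> digit d n = 0"
    "digit d (int (ord d)) = 0 \<Longrightarrow> ord d = 0"
    using D by auto
  have "\<exists>m\<le>min n (int (ord d)). digit d m \<noteq> 9"
    using D by (meson min.cobounded2)
  then show "\<exists>m\<le>n. digit d m \<noteq> 9" by auto
  show "neg d \<Longrightarrow> \<exists>n. digit d n \<noteq> 0" using D by metis
qed

lemma decimal_eqI:
  assumes "neg d = neg e" "ord d = ord e" "digit d = digit e"
  shows "d = e"
  using assms unfolding neg_def ord_def digit_def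
  by (simp add: prod_eq_iff flip: Rep_decimal_inject)

lemma decimal_of_triple:
  assumes "is_decimal s k f"
  obtains d where "neg d = s" "ord d = k" "digit d = f"
proof
  have "Rep_decimal (Abs_decimal (s, k, f)) = (s, k, f)"
    using assms by (intro Abs_decimal_inverse) simp
  then show "neg (Abs_decimal (s, k, f)) = s" "ord (Abs_decimal (s, k, f)) = k"
    "digit (Abs_decimal (s, k, f)) = f"
    by (simp_all add: neg_def ord_def digit_def)
qed

lemma digit_sum_above: "n > int (ord d) \<Longrightarrow> digit_sum d n = 0"
  by (simp add: digit_sum_def)

lemma digit_sum_rec: "digit_sum d n = real (digit d n) * 10 powi n + digit_sum d (n + 1)"
proof (cases "n \<le> int (ord d)")
  case True
  then have "{n..int (ord d)} = insert n {n + 1..int (ord d)}" by auto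
  then show ?thesis by (simp add: digit_sum_def)
next
  case False
  then show ?thesis by (simp add: digit_sum_above digit_above_ord)
qed

lemma powi_Suc_10: "(10 :: real) powi (n + 1) = 10 * 10 powi n"
  by (simp add: power_int_add)

lemma powi_10_pos: "(0 :: real) < 10 powi n"
  by simp

lemma digit_sum_antimono: "m \<le> n \<Longrightarrow> digit_sum d n \<le> digit_sum d m"
proof (induction rule: int_le_induct)
  case (step i)
  have "digit_sum d i \<le> digit_sum d (i - 1)" using digit_sum_rec[of d "i - 1"] by simp
  then show ?case using step by linarith
qed simp

text \<open>
  The upper bounds that belong to the truncations decrease because a digit is at most \<open>9\<close>.
\<close>

lemma digit_sum_upper_mono:
  "m \<le> n \<Longrightarrow> digit_sum d m + 10 powi m \<le> digit_sum d n + 10 powi n"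
proof (induction rule: int_le_induct)
  case (step i)
  have "real (digit d (i - 1)) * 10 powi (i - 1) \<le> 9 * 10 powi (i - 1)"
    using digit_le_9[of d "i - 1"] by (intro mult_right_mono) simp_all
  moreover have "digit_sum d (i - 1) = real (digit d (i - 1)) * 10 powi (i - 1) + digit_sum d i"
    using digit_sum_rec[of d "i - 1"] by simp
  moreover have "(10 :: real) powi i = 10 * 10 powi (i - 1)"
    using powi_Suc_10[of "i - 1"] by simp
  ultimately show ?case using step by linarith
qed simp

lemma digit_sum_integer: "\<exists>z. digit_sum d n = of_int z * 10 powi n"
proof (cases "n \<le> int (ord d)")
  case False
  then show ?thesis by (intro exI[of _ 0]) (simp add: digit_sum_above)
next
  case True
  then show ?thesis
  proof (induction rule: int_le_induct)
    case base
    show ?case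
      using digit_sum_rec[of d "int (ord d)"] by (auto simp: digit_sum_above)
        (metis of_int_of_nat_eq)
  next
    case (step i)
    then obtain z where z: "digit_sum d i = of_int z * 10 powi i" by blast
    have "digit_sum d (i - 1) = of_int (int (digit d (i - 1)) + 10 * z) * 10 powi (i - 1)"
      using digit_sum_rec[of d "i - 1"] powi_Suc_10[of "i - 1"] z by (simp add: algebra_simps)
    then show ?case by blast
  qed
qed

lemma digit_sum_tendsto: "(\<lambda>m. digit_sum d (- int m)) \<longlonglongrightarrow> abs_val d"
proof -
  have "incseq (\<lambda>m. digit_sum d (- int m))"
    by (intro incseq_SucI digit_sum_antimono) simp
  moreover have "digit_sum d (- int m) \<le> digit_sum d 0 + 10 powi 0" for m
    using digit_sum_upper_mono[of "- int m" 0 d] powi_10_pos[of "- int m"] by linarith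
  ultimately have "convergent (\<lambda>m. digit_sum d (- int m))"
    using incseq_convergent unfolding convergent_def by metis
  then show ?thesis by (simp add: abs_val_def convergent_LIMSEQ_iff)
qed

lemma digit_sum_le_abs_val: "digit_sum d n \<le> abs_val d"
proof (rule LIMSEQ_le_const[OF digit_sum_tendsto])
  show "\<exists>N. \<forall>m\<ge>N. digit_sum d n \<le> digit_sum d (- int m)"
    by (intro exI[of _ "nat (- n)"]) (auto intro: digit_sum_antimono)
qed

text \<open>
  The inequality is strict because some later digit differs from \<open>9\<close>, and there the upper bound drops.
\<close>

lemma abs_val_less: "abs_val d < digit_sum d n + 10 powi n"
proof -
  have le: "abs_val d \<le> digit_sum d n + 10 powi n" for n
  proof (rule LIMSEQ_le_const2[OF digit_sum_tendsto])
    have "digit_sum d (- int m) \<le> digit_sum d n + 10 powi n" if "m \<ge> nat (- n)" for m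
    proof -
      have "- int m \<le> n" using that by simp
      then show ?thesis
        using digit_sum_upper_mono[of "- int m" n d] powi_10_pos[of "- int m"] by linarith
    qed
    then show "\<exists>N. \<forall>m\<ge>N. digit_sum d (- int m) \<le> digit_sum d n + 10 powi n" by blast
  qed
  obtain m where m: "m \<le> n - 1" "digit d m \<noteq> 9" using no_tail_9 by blast
  then have "real (digit d m) \<le> 8" using digit_le_9[of d m] by simp
  then have "real (digit d m) * 10 powi m \<le> 8 * 10 powi m"
    by (intro mult_right_mono) simp_all
  then have "digit_sum d m + 10 powi m < digit_sum d (m + 1) + 10 powi (m + 1)"
    using digit_sum_rec[of d m] powi_Suc_10[of m] powi_10_pos[of m] by linarith
  also have "\<dots> \<le> digit_sum d n + 10 powi n"
    using m by (intro digit_sum_upper_mono) simp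
  finally show ?thesis using le[of m] by simp
qed

text \<open>
  The truncation is an integer multiple of \<open>10 powi n\<close>, and the limit exceeds it by less than one
  such unit. Hence the real number determines all truncations, and with them all digits.
\<close>

lemma floor_abs_val: "digit_sum d n = of_int \<lfloor>abs_val d / 10 powi n\<rfloor> * 10 powi n"
proof -
  obtain z where z: "digit_sum d n = of_int z * 10 powi n" using digit_sum_integer by blast
  have "of_int z \<le> abs_val d / 10 powi n" "abs_val d / 10 powi n < of_int z + 1"
    using digit_sum_le_abs_val[of d n] abs_val_less[of d n]
    by (simp_all add: z field_simps)
  then have "\<lfloor>abs_val d / 10 powi n\<rfloor> = z" by linarith
  then show ?thesis using z by simp
qed

lemma abs_val_nonneg: "0 \<le> abs_val d"
  using digit_sum_le_abs_val[of d "int (ord d) + 1"] by (simp add: digit_sum_above)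

lemma abs_val_pos: "digit d n \<noteq> 0 \<Longrightarrow> 0 < abs_val d"
proof -
  assume "digit d n \<noteq> 0"
  then have "0 < real (digit d n) * 10 powi n" by simp
  also have "\<dots> \<le> digit_sum d n"
    using digit_sum_rec[of d n] digit_sum_antimono[of "n + 1" "max (n + 1) (int (ord d) + 1)" d]
    by (simp add: digit_sum_above)
  also have "\<dots> \<le> abs_val d" by (rule digit_sum_le_abs_val)
  finally show ?thesis .
qed

text \<open>
  The order is determined by the digits, being the position of the leading nonzero digit, or \<open>0\<close> if
  there is none at a positive position.
\<close>

lemma abs_val_inject:
  assumes "abs_val d = abs_val e"
  shows "digit d = digit e" "ord d = ord e"
proof -
  have sum: "digit_sum d n = digit_sum e n" for n
    using floor_abs_val[of d n] floor_abs_val[of e n] assms by simp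
  show dig: "digit d = digit e"
  proof
    fix n
    have "real (digit d n) * 10 powi n = real (digit e n) * 10 powi n"
      using digit_sum_rec[of d n] digit_sum_rec[of e n] sum by simp
    then show "digit d n = digit e n" by simp
  qed
  have "\<not> ord x < ord y" if "digit x = digit y" for x y
    using digit_above_ord[of x "int (ord y)"] digit_ord[of y] that by auto
  then show "ord d = ord e" using dig by (metis linorder_neqE_nat)
qed

text \<open>
  The sign can be read off from the value because a minus sign only occurs with a nonzero digit.
\<close>

lemma val_inject: "val d = val e \<longleftrightarrow> d = e"
proof
  assume eq: "val d = val e"
  have abs: "\<bar>val x\<bar> = abs_val x" for x
    using abs_val_nonneg[of x] by (simp add: val_def sgn_dec_def)
  have neg: "neg x \<longleftrightarrow> val x < 0" for x
    using abs_val_nonneg[of x] not_minus_zero[of x] abs_val_pos[of x]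
    by (auto simp: val_def sgn_dec_def)
  have "abs_val d = abs_val e" using eq abs by metis
  then show "d = e"
    using abs_val_inject[of d e] neg eq by (intro decimal_eqI) simp_all
qed simp

lemma powi_10_small: "(\<lambda>m. (10 :: real) powi (- int m)) \<longlonglongrightarrow> 0"
proof -
  have "(\<lambda>m. (1 / 10 :: real) ^ m) \<longlonglongrightarrow> 0" by (rule LIMSEQ_power_zero) simp
  then show ?thesis by (simp add: power_int_minus power_one_over inverse_eq_divide)
qed

text \<open>
  The digits of \<open>r\<close> are those of the integers \<open>\<lfloor>r / 10 powi n\<rfloor>\<close>, and the order is the least \<open>k\<close> with
  \<open>r < 10 ^ (k + 1)\<close>.
\<close>

lemma decimal_digits_of_real:
  fixes r :: real
  assumes "0 \<le> r"
  defines "F \<equiv> \<lambda>n. \<lfloor>r / 10 powi n\<rfloor>"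
  obtains k where "is_decimal (s \<and> r \<noteq> 0) k (\<lambda>n. nat (F n mod 10))"
    "\<And>n. n > int k \<Longrightarrow> F n = 0"
proof -
  have F_nonneg: "0 \<le> F n" for n using assms by (simp add: F_def)
  have F_rec: "F n = F n mod 10 + 10 * F (n + 1)" for n
  proof -
    have "r / 10 powi (n + 1) = r / 10 powi n / real_of_int 10"
      by (simp add: powi_Suc_10)
    then have "F (n + 1) = F n div 10"
      unfolding F_def by (simp only: floor_divide_real_eq_div[of 10 "r / 10 powi n"])
    then show ?thesis by simp
  qed
  have F_bounds: "of_int (F n) * 10 powi n \<le> r" "r < (of_int (F n) + 1) * 10 powi n" for n
    unfolding F_def using floor_divide_lower[of "10 powi n" r] floor_divide_upper[of "10 powi n" r]
    by simp_all
  have F_0: "F n = 0 \<longleftrightarrow> r < 10 powi n" for n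
    using assms by (simp add: F_def floor_eq_iff)
  obtain k0 where "r < 10 ^ k0" using real_arch_pow[of 10 r] by auto
  then have k0: "r < 10 ^ Suc k0" by (simp add: order_less_le_trans)
  define k where "k = (LEAST k. r < 10 ^ Suc k)"
  have k: "r < 10 ^ Suc k" unfolding k_def by (rule LeastI[of _ k0]) (rule k0)
  have k_least: "10 ^ k \<le> r" if "k > 0"
    using not_less_Least[of "k - 1" "\<lambda>k. r < 10 ^ Suc k"] that
    unfolding k_def[symmetric] by simp
  have above: "F n = 0" if "n > int k" for n
  proof -
    have "(10 :: real) ^ Suc k = 10 powi (int k + 1)" by (simp add: power_int_add)
    also have "\<dots> \<le> 10 powi n" using that by (intro power_int_increasing) simp_all
    finally show ?thesis using k by (simp add: F_0)
  qed
  have "is_decimal (s \<and> r \<noteq> 0) k (\<lambda>n. nat (F n mod 10))"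
    unfolding is_decimal_def
  proof (intro conjI allI impI notI)
    fix n :: int
    have "F n mod 10 < 10" by simp
    then show "nat (F n mod 10) \<le> 9" by linarith
  next
    fix n :: int assume "int k < n"
    then show "nat (F n mod 10) = 0" by (simp add: above)
  next
    assume "nat (F (int k) mod 10) = 0"
    moreover have "F (int k) = F (int k) mod 10"
      using F_rec[of "int k"] above[of "int k + 1"] by simp
    ultimately have "F (int k) = 0" using F_nonneg[of "int k"] by simp
    then show "k = 0" using k_least F_0[of "int k"] by (cases "k > 0") auto
  next
    assume "\<exists>n\<le>int k. \<forall>m\<le>n. nat (F m mod 10) = 9"
    then obtain n where 9: "\<And>m. m \<le> n \<Longrightarrow> F m mod 10 = 9"
      by (metis F_nonneg nat_eq_iff2 of_nat_numeral zero_neq_numeral)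
    have const: "(of_int (F m) + 1) * 10 powi m = ((of_int (F n) + 1) * 10 powi n :: real)"
      if "m \<le> n" for m
      using that
    proof (induction rule: int_le_induct)
      case (step i)
      have "F (i - 1) = 9 + 10 * F i"
        using F_rec[of "i - 1"] 9[of "i - 1"] step by simp
      then show ?case
        using step powi_Suc_10[of "i - 1"] by (simp add: algebra_simps)
    qed simp
    \<comment> \<open>If all digits from \<open>n\<close> on were \<open>9\<close>, the upper bounds of \<open>r\<close> would not change any more, and their
      distance to \<open>r\<close> would be positive and below every power of ten.\<close>
    define gap where "gap = (of_int (F n) + 1) * 10 powi n - r"
    have "0 < gap" using F_bounds(2)[of n] by (simp add: gap_def)
    moreover have "gap \<le> 10 powi (- int m)" if "nat (- n) \<le> m" for m
    proof -
      have "- int m \<le> n" using that by simp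
      then show ?thesis
        using const[of "- int m"] F_bounds(1)[of "- int m"] by (simp add: gap_def algebra_simps)
    qed
    then have "gap \<le> 0"
      by (intro LIMSEQ_le_const[OF powi_10_small] exI[of _ "nat (- n)"]) blast
    ultimately show False by simp
  next
    assume *: "(s \<and> r \<noteq> 0) \<and> k = 0 \<and> (\<forall>n\<le>0. nat (F n mod 10) = 0)"
    \<comment> \<open>If all digits at nonpositive positions vanish, \<open>r\<close> is below every power of ten.\<close>
    have "F n = 0" if "n \<le> 1" for n
      using that
    proof (induction rule: int_le_induct)
      case base
      show ?case using above * by simp
    next
      case (step i)
      have "nat (F (i - 1) mod 10) = 0" using * step by simp
      moreover have "0 \<le> F (i - 1) mod 10" by simp
      ultimately have "F (i - 1) mod 10 = 0" by linarith
      then show ?case using F_rec[of "i - 1"] step by simp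
    qed
    then have "r \<le> 10 powi (- int m)" for m
      using F_0[of "- int m"] by (simp add: less_imp_le)
    then have "r \<le> 0"
      by (intro LIMSEQ_le_const[OF powi_10_small]) blast
    then show False using * assms by simp
  qed
  then show thesis using above that by blast
qed

lemma val_surj: "\<exists>d. val d = r"
proof -
  define F where "F n = \<lfloor>\<bar>r\<bar> / 10 powi n\<rfloor>" for n
  obtain k where k: "is_decimal (r < 0 \<and> \<bar>r\<bar> \<noteq> 0) k (\<lambda>n. nat (F n mod 10))"
    and above: "\<And>n. n > int k \<Longrightarrow> F n = 0"
    using decimal_digits_of_real[of "\<bar>r\<bar>" "r < 0"] unfolding F_def by auto
  obtain d where d: "neg d = (r < 0 \<and> \<bar>r\<bar> \<noteq> 0)" "ord d = k" "digit d = (\<lambda>n. nat (F n mod 10))"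
    using decimal_of_triple[OF k] .
  have "digit_sum d n = of_int (F n) * 10 powi n" for n
  proof (cases "n \<le> int k")
    case False
    then show ?thesis using above by (simp add: digit_sum_above d)
  next
    case True
    then have "n \<le> int k + 1" by simp
    then show ?thesis
    proof (induction rule: int_le_induct)
      case base
      show ?case using above by (simp add: digit_sum_above d)
    next
      case (step i)
      have "F i = F (i - 1) div 10"
      proof -
        have "\<bar>r\<bar> / 10 powi i = \<bar>r\<bar> / 10 powi (i - 1) / real_of_int 10"
          using powi_Suc_10[of "i - 1"] by simp
        then show ?thesis
          unfolding F_def by (simp only: floor_divide_real_eq_div[of 10 "\<bar>r\<bar> / 10 powi (i - 1)"])
      qed
      then have "F (i - 1) = F (i - 1) mod 10 + 10 * F i" by simp
      then have "real_of_int (F (i - 1)) = of_int (F (i - 1) mod 10) + 10 * of_int (F i)"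
        by linarith
      then show ?case
        using digit_sum_rec[of d "i - 1"] powi_Suc_10[of "i - 1"] step
        by (simp add: d algebra_simps)
    qed
  qed
  then have bounds: "digit_sum d n \<le> \<bar>r\<bar>" "\<bar>r\<bar> - 10 powi n \<le> digit_sum d n" for n
    unfolding F_def using floor_divide_lower[of "10 powi n" "\<bar>r\<bar>"]
      floor_divide_upper[of "10 powi n" "\<bar>r\<bar>"]
    by (simp_all add: algebra_simps)
  have "(\<lambda>m. digit_sum d (- int m)) \<longlonglongrightarrow> \<bar>r\<bar>"
  proof (rule tendsto_sandwich)
    show "(\<lambda>m. \<bar>r\<bar> - 10 powi (- int m)) \<longlonglongrightarrow> \<bar>r\<bar>"
      using tendsto_diff[OF tendsto_const powi_10_small, of "\<bar>r\<bar>"] by simp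
    show "\<forall>\<^sub>F m in sequentially. \<bar>r\<bar> - 10 powi (- int m) \<le> digit_sum d (- int m)"
      "\<forall>\<^sub>F m in sequentially. digit_sum d (- int m) \<le> \<bar>r\<bar>"
      using bounds by (auto intro: always_eventually)
  qed (rule tendsto_const)
  then have "abs_val d = \<bar>r\<bar>" using LIMSEQ_unique digit_sum_tendsto by blast
  then have "val d = r" using d(1) by (auto simp: val_def sgn_dec_def)
  then show ?thesis by blast
qed

lemma of_rat_trunc: "real_of_rat (trunc d m) = sgn_dec d * digit_sum d (- int m)"
proof -
  have "real_of_rat (10 powi n) = 10 powi n" for n
    by (simp add: power_int_def of_rat_power of_rat_inverse of_rat_divide)
  then show ?thesis
    by (simp add: trunc_def sgn_dec_def digit_sum_def of_rat_sum of_rat_mult of_rat_minus)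
qed

lemma trunc_tendsto: "(\<lambda>m. real_of_rat (trunc d m)) \<longlonglongrightarrow> val d"
  unfolding of_rat_trunc val_def by (intro tendsto_mult tendsto_const digit_sum_tendsto)

lemma QD_mult:
  assumes "x \<in> QD" "y \<in> QD"
  shows "x * y \<in> QD"
proof -
  obtain a b m n where xy: "x = of_int a / 10 ^ m" "y = of_int b / 10 ^ n"
    using assms unfolding QD_def by blast
  have "x * y = of_int (a * b) / 10 ^ (m + n)"
    by (simp add: xy power_add)
  then show ?thesis unfolding QD_def by blast
qed

lemma QD_add:
  assumes "x \<in> QD" "y \<in> QD"
  shows "x + y \<in> QD"
proof -
  obtain a b m n where xy: "x = of_int a / 10 ^ m" "y = of_int b / 10 ^ n"
    using assms unfolding QD_def by blast
  have "x + y = of_int (a * 10 ^ n + b * 10 ^ m) / 10 ^ (m + n)"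
    by (simp add: xy field_simps power_add)
  then show ?thesis unfolding QD_def by blast
qed

lemma QD_of_int: "of_int a \<in> QD"
proof -
  have "of_int a = (of_int a / 10 ^ 0 :: rat)" by simp
  then show ?thesis unfolding QD_def by blast
qed

lemma QD_powi: "10 powi n \<in> QD"
proof (cases "n \<ge> 0")
  case True
  then have "10 powi n = (of_int (10 ^ nat n) :: rat)" by (simp add: power_int_def)
  then show ?thesis using QD_of_int by metis
next
  case False
  then have "10 powi n = (of_int 1 / 10 ^ nat (- n) :: rat)"
    by (simp add: power_int_def power_one_over inverse_eq_divide)
  then show ?thesis unfolding QD_def by blast
qed

lemma trunc_in_QD: "trunc d m \<in> QD"
proof -
  have nat: "of_nat c * 10 powi n \<in> QD" for c n
    using QD_mult[OF QD_of_int[of "int c"] QD_powi[of n]] by simp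
  have "(\<Sum>n\<in>I. of_nat (digit d n) * 10 powi n) \<in> QD" if "finite I" for I
    using that
  proof induction
    case empty
    show ?case using QD_of_int[of 0] by simp
  next
    case (insert n I)
    then show ?case using QD_add nat by simp
  qed
  moreover have "(if neg d then - 1 else 1) \<in> QD"
    using QD_of_int[of 1] QD_of_int[of "- 1"] by simp
  ultimately show ?thesis unfolding trunc_def by (intro QD_mult) auto
qed

lemma of_rat_abs_less_iff: "\<bar>x - y\<bar> < 1 / of_nat k \<longleftrightarrow>
    \<bar>real_of_rat x - real_of_rat y\<bar> < 1 / real k"
proof -
  have "\<bar>x - y\<bar> < 1 / of_nat k \<longleftrightarrow> real_of_rat \<bar>x - y\<bar> < real_of_rat (1 / of_nat k)"
    by (simp only: of_rat_less)
  then show ?thesis by (simp add: of_rat_diff of_rat_divide flip: abs_of_rat)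
qed

text \<open>
  Generating a decimal is convergence to its value, since the truncations themselves converge to it.
\<close>

lemma generates_iff:
  "generates a d \<longleftrightarrow> (\<forall>n\<ge>1. a n \<in> QD) \<and> (\<lambda>n. real_of_rat (a n)) \<longlonglongrightarrow> val d"
proof
  assume gen: "generates a d"
  have "(\<lambda>n. real_of_rat (trunc d n) - real_of_rat (a n)) \<longlonglongrightarrow> 0"
  proof (rule LIMSEQ_I)
    fix e :: real assume "0 < e"
    then obtain k where k: "k > 0" "1 / real k < e"
      by (metis inverse_eq_divide reals_Archimedean zero_less_Suc)
    then obtain n0 where "\<forall>n\<ge>n0. \<bar>trunc d n - a n\<bar> < 1 / of_nat k"
      using gen unfolding generates_def by (metis Suc_leI One_nat_def)
    then show "\<exists>no. \<forall>n\<ge>no. norm (real_of_rat (trunc d n) - real_of_rat (a n) - 0) < e"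
      unfolding of_rat_abs_less_iff using k(2) by (intro exI[of _ n0]) fastforce
  qed
  then have "(\<lambda>n. real_of_rat (a n)) \<longlonglongrightarrow> val d"
    using tendsto_diff[OF trunc_tendsto[of d]] by force
  then show "(\<forall>n\<ge>1. a n \<in> QD) \<and> (\<lambda>n. real_of_rat (a n)) \<longlonglongrightarrow> val d"
    using gen by (simp add: generates_def cauchy_QD_def)
next
  assume a: "(\<forall>n\<ge>1. a n \<in> QD) \<and> (\<lambda>n. real_of_rat (a n)) \<longlonglongrightarrow> val d"
  have "\<exists>n0\<ge>1. \<forall>m\<ge>n0. \<forall>n\<ge>n0. \<bar>a m - a n\<bar> < 1 / of_nat k" if "k \<ge> 1" for k
  proof -
    have "Cauchy (\<lambda>n. real_of_rat (a n))" using a LIMSEQ_imp_Cauchy by blast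
    moreover have "0 < 1 / real k" using that by simp
    ultimately obtain M where "\<forall>m\<ge>M. \<forall>n\<ge>M. norm (real_of_rat (a m) - real_of_rat (a n)) < 1 / real k"
      using CauchyD by blast
    then show ?thesis unfolding of_rat_abs_less_iff by (intro exI[of _ "max 1 M"]) auto
  qed
  moreover have "\<exists>n0\<ge>1. \<forall>n\<ge>n0. \<bar>trunc d n - a n\<bar> < 1 / of_nat k" if "k \<ge> 1" for k
  proof -
    have "(\<lambda>n. real_of_rat (trunc d n) - real_of_rat (a n)) \<longlonglongrightarrow> 0"
      using tendsto_diff[OF trunc_tendsto[of d] conjunct2[OF a]] by simp
    moreover have "0 < 1 / real k" using that by simp
    ultimately obtain M where
      "\<forall>n\<ge>M. norm (real_of_rat (trunc d n) - real_of_rat (a n) - 0) < 1 / real k"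
      using LIMSEQ_D by blast
    then show ?thesis unfolding of_rat_abs_less_iff by (intro exI[of _ "max 1 M"]) auto
  qed
  ultimately show "generates a d"
    using a unfolding generates_def cauchy_QD_def by blast
qed

text \<open>
  The decimal with value \<open>val d * val e\<close> is generated by the products of truncations, and no other
  decimal is generated by such products because limits are unique and \<open>val\<close> is injective.
\<close>

lemma val_mult: "val (d \<cdot>\<^sub>R e) = val d * val e"
proof -
  obtain c where c: "val c = val d * val e" using val_surj by blast
  have "d \<cdot>\<^sub>R e = c"
    unfolding decimal_mult_def
  proof (rule the_equality)
    have "generates (trunc d) d" "generates (trunc e) e"
      by (simp_all add: generates_iff trunc_in_QD trunc_tendsto)
    moreover have "generates (\<lambda>n. trunc d n * trunc e n) c"
      using tendsto_mult[OF trunc_tendsto[of d] trunc_tendsto[of e]]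
      by (simp add: generates_iff QD_mult trunc_in_QD of_rat_mult c)
    ultimately show "\<exists>a b. generates a d \<and> generates b e \<and> generates (\<lambda>n. a n * b n) c"
      by blast
  next
    fix c' assume "\<exists>a b. generates a d \<and> generates b e \<and> generates (\<lambda>n. a n * b n) c'"
    then obtain a b where "(\<lambda>n. real_of_rat (a n)) \<longlonglongrightarrow> val d"
      "(\<lambda>n. real_of_rat (b n)) \<longlonglongrightarrow> val e" "(\<lambda>n. real_of_rat (a n * b n)) \<longlonglongrightarrow> val c'"
      by (auto simp: generates_iff)
    then have "val c' = val d * val e"
      using LIMSEQ_unique[OF _ tendsto_mult] by (simp add: of_rat_mult)
    then show "c' = c" using c val_inject[of c' c] by simp
  qed
  then show ?thesis using c by simp
qed

section \<open>The words of the canonical encoding\<close>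

lemma binary_inject: "binary m = binary n \<Longrightarrow> m = n"
  by (metis bits_value_binary)

lemma binary_not_Nil: "binary n \<noteq> []"
  by (subst binary.simps) simp

lemma digits_Sep_inject:
  "(map Digit xs @ [Sep]) \<frown> v = (map Digit ys @ [Sep]) \<frown> w \<Longrightarrow> xs = ys \<and> v = w"
proof (induction xs arbitrary: ys)
  case Nil
  then show ?case by (cases ys) auto
next
  case (Cons x xs)
  then show ?case by (cases ys) auto
qed

lemma u_0_eq_Minus: "u d 0 = Minus \<longleftrightarrow> neg d"
proof -
  obtain b bs where "binary (ord d) = b # bs"
    using binary_not_Nil by (meson list.exhaust)
  then show ?thesis by (simp add: u_def)
qed

text \<open>
  The encoding can be parsed: only a minus sign can make \<open>Minus\<close> the first letter, and the first \<open>Sep\<close>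
  ends the order.
\<close>

lemma inj_u: "inj u"
proof (rule injI)
  fix x y assume eq: "u x = u y"
  have neg: "neg x = neg y" using eq u_0_eq_Minus by metis
  let ?t = "\<lambda>x i. Digit (digit x (int (ord x) - int i))"
  have "(map Digit (binary (ord x)) @ [Sep]) \<frown> ?t x = (map Digit (binary (ord y)) @ [Sep]) \<frown> ?t y"
    using eq neg unfolding u_def by (cases "neg y") simp_all
  then have "binary (ord x) = binary (ord y)" and t: "?t x = ?t y"
    using digits_Sep_inject by blast+
  then have ord: "ord x = ord y" by (simp add: binary_inject)
  have "digit x n = digit y n" for n
  proof (cases "n > int (ord x)")
    case True
    then show ?thesis using ord by (simp add: digit_above_ord)
  next
    case False
    then have "int (ord x) - int (nat (int (ord x) - n)) = n" by simp
    then show ?thesis using fun_cong[OF t, of "nat (int (ord x) - n)"] ord by simp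
  qed
  then show "x = y" using neg ord by (intro decimal_eqI) auto
qed

abbreviation digit_symbols :: "symbol set" where
  "digit_symbols \<equiv> Digit ` {0..9}"

lemma encoding_X_R: "encoding A_R X_R"
proof -
  have "set (binary n) \<subseteq> {0..9}" for n
    using set_binary[of n] by auto
  then have "range (u d) \<subseteq> A_R" for d
    using digit_le_9[of d] by (auto simp: u_def A_R_def)
  then show ?thesis
    by (auto simp: encoding_def X_R_def A_R_def)
qed

definition zero_word :: "symbol word" where
  "zero_word = [Digit 0, Sep] \<frown> (\<lambda>_. Digit 0)"

definition nonzero_words :: "symbol word set" where
  "nonzero_words = u ` {x. val x \<noteq> 0}"

lemma val_eq_0_iff: "val d = 0 \<longleftrightarrow> (\<forall>n. digit d n = 0)"
proof
  assume "val d = 0"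
  then have "abs_val d = 0" by (auto simp: val_def sgn_dec_def split: if_splits)
  then show "\<forall>n. digit d n = 0" using abs_val_pos by (metis less_irrefl)
next
  assume "\<forall>n. digit d n = 0"
  then have "abs_val d = 0" by (simp add: abs_val_def digit_sum_def)
  then show "val d = 0" by (simp add: val_def)
qed

lemma u_zero: "val d = 0 \<Longrightarrow> u d = zero_word"
proof -
  assume "val d = 0"
  then have 0: "digit d n = 0" for n by (simp add: val_eq_0_iff)
  moreover have "ord d = 0" using 0 digit_ord by blast
  moreover have "\<not> neg d" using 0 not_minus_zero[of d] by auto
  ultimately show ?thesis by (simp add: u_def zero_word_def binary.simps[of 0])
qed

lemma X_R_eq: "X_R = insert zero_word nonzero_words" and zero_word_notin: "zero_word \<notin> nonzero_words"
proof -
  obtain z where z: "val z = 0" using val_surj by blast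
  have uz: "u z = zero_word" using z by (rule u_zero)
  have "x \<in> insert zero_word nonzero_words" if "x \<in> X_R" for x
    using that u_zero by (auto simp: X_R_def nonzero_words_def)
  moreover have "zero_word \<in> X_R" using uz by (metis X_R_def rangeI)
  moreover have "nonzero_words \<subseteq> X_R" by (auto simp: X_R_def nonzero_words_def)
  ultimately show "X_R = insert zero_word nonzero_words" by blast
  show "zero_word \<notin> nonzero_words"
    unfolding uz[symmetric] nonzero_words_def using z inj_u by (auto dest: injD)
qed

lemma uncountable_nonzero_words: "uncountable nonzero_words"
proof
  assume "countable nonzero_words"
  then have "countable (val ` inv u ` nonzero_words)" by simp
  moreover have "val ` inv u ` nonzero_words = UNIV - {0}"
    unfolding nonzero_words_def image_inv_f_f[OF inj_u]
    using val_surj by (auto simp: image_iff) metis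
  ultimately show False
    using uncountable_UNIV_real uncountable_minus_countable[of UNIV "{0 :: real}"] by simp
qed

text \<open>
  The beginnings of the words of nonzero decimals up to and including the first nonzero digit
  \<open>c\<close>. Zeros before \<open>c\<close> occur only if the order is \<open>0\<close>.
\<close>

definition stem :: "symbol list \<Rightarrow> bool" where
  "stem s \<longleftrightarrow> (\<exists>sg k j c.
     s = ((if sg then [Minus] else []) @ map Digit (binary k) @ [Sep]) @
       replicate j (Digit 0) @ [Digit c] \<and> 0 < c \<and> c \<le> 9 \<and> (j > 0 \<longrightarrow> k = 0))"

text \<open>
  The digit sequences that may follow a stem.
\<close>

definition tails :: "symbol word set" where
  "tails = {t. range t \<subseteq> digit_symbols \<and> (\<forall>n. \<exists>i\<ge>n. t i \<noteq> Digit 9)}"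

text \<open>
  Since the stem contains a nonzero digit, it makes the decimal nonzero and settles the conditions on
  the leading digit and on the minus sign; the tail only has to avoid ending in nines.
\<close>

lemma stem_conc_tail:
  assumes "stem s" "t \<in> tails"
  shows "s \<frown> t \<in> nonzero_words"
proof -
  obtain sg k j c where
    s: "s = ((if sg then [Minus] else []) @ map Digit (binary k) @ [Sep]) @
       replicate j (Digit 0) @ [Digit c]"
    and c: "0 < c" "c \<le> 9" and j: "j > 0 \<Longrightarrow> k = 0"
    using assms(1) unfolding stem_def by metis
  have "\<forall>i. \<exists>x. t i = Digit x \<and> x \<le> 9"
    using assms(2) by (fastforce simp: tails_def)
  then obtain t' where t': "\<And>i. t i = Digit (t' i)" "\<And>i. t' i \<le> 9" by metis
  \<comment> \<open>The digits of the word in the order in which they are written.\<close>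
  define D where "D i = (if i < j then 0 else if i = j then c else t' (i - Suc j))" for i
  define f where "f n = (if n \<le> int k then D (nat (int k - n)) else 0)" for n
  have f: "f (int k - int i) = D i" for i by (simp add: f_def)
  have "is_decimal sg k f"
    unfolding is_decimal_def
  proof (intro conjI allI impI)
    fix n show "f n \<le> 9" using c t' by (simp add: f_def D_def)
  next
    fix n assume "int k < n"
    then show "f n = 0" by (simp add: f_def)
  next
    assume "f (int k) = 0"
    then show "k = 0" using f[of 0] c j by (cases "j = 0") (simp_all add: D_def)
  next
    show "\<not> (\<exists>n\<le>int k. \<forall>m\<le>n. f m = 9)"
    proof
      assume "\<exists>n\<le>int k. \<forall>m\<le>n. f m = 9"
      then obtain n where n: "n \<le> int k" "\<And>m. m \<le> n \<Longrightarrow> f m = 9" by blast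
      obtain i where i: "i \<ge> nat (int k - n)" "t i \<noteq> Digit 9"
        using assms(2) by (auto simp: tails_def)
      then have "f (int k - int (i + Suc j)) = 9" by (intro n(2)) simp
      then show False using i t' by (simp only: f) (simp add: D_def)
    qed
  next
    show "\<not> (sg \<and> k = 0 \<and> (\<forall>n\<le>0. f n = 0))"
    proof
      assume "sg \<and> k = 0 \<and> (\<forall>n\<le>0. f n = 0)"
      then have "f (int k - int j) = 0" by simp
      then show False using c by (simp only: f) (simp add: D_def)
    qed
  qed
  then obtain d where d: "neg d = sg" "ord d = k" "digit d = f"
    by (rule decimal_of_triple)
  have "(\<lambda>i. Digit (D i)) = (replicate j (Digit 0) @ [Digit c]) \<frown> t"
    by (auto simp: fun_eq_iff conc_def D_def t' nth_append)
  then have "u d = s \<frown> t"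
    by (simp add: u_def d f s)
  moreover have "val d \<noteq> 0"
    using f[of j] c by (auto simp: val_eq_0_iff d D_def intro: exI[of _ "int k - int j"])
  ultimately show ?thesis
    unfolding nonzero_words_def by (intro image_eqI[of _ _ d]) simp_all
qed

lemma nonzero_words_split:
  assumes "w \<in> nonzero_words"
  obtains s t where "stem s" "t \<in> tails" "w = s \<frown> t"
proof -
  obtain x where x: "val x \<noteq> 0" "w = u x" using assms by (auto simp: nonzero_words_def)
  let ?D = "\<lambda>i. digit x (int (ord x) - int i)"
  obtain n where n: "digit x n \<noteq> 0" using x by (auto simp: val_eq_0_iff)
  then have "?D (nat (int (ord x) - n)) \<noteq> 0"
    using digit_above_ord[of x n] by (cases "n \<le> int (ord x)") auto
  then have ex: "\<exists>i. ?D i \<noteq> 0" by blast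
  define j where "j = (LEAST i. ?D i \<noteq> 0)"
  have j: "?D j \<noteq> 0" unfolding j_def by (rule LeastI_ex[OF ex])
  have less_j: "?D i = 0" if "i < j" for i
    using not_less_Least[of i "\<lambda>i. ?D i \<noteq> 0"] that unfolding j_def by blast
  define t where "t i = Digit (?D (i + Suc j))" for i
  define s where "s = ((if neg x then [Minus] else []) @ map Digit (binary (ord x)) @ [Sep]) @
       replicate j (Digit 0) @ [Digit (?D j)]"
  have "ord x = 0" if "j > 0" using less_j[OF that] digit_ord[of x] by simp
  then have "stem s"
    unfolding stem_def s_def using j digit_le_9 by blast
  moreover have "t \<in> tails"
    unfolding tails_def
  proof (intro CollectI conjI allI)
    show "range t \<subseteq> digit_symbols" using digit_le_9 by (auto simp: t_def)
    fix n
    obtain m where m: "m \<le> int (ord x) - int (n + Suc j)" "digit x m \<noteq> 9"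
      using no_tail_9 by blast
    define i where "i = nat (int (ord x) - int (Suc j) - m)"
    have "i \<ge> n" "int (ord x) - int (i + Suc j) = m" using m(1) by (simp_all add: i_def)
    then show "\<exists>i\<ge>n. t i \<noteq> Digit 9" using m(2) by (auto simp: t_def simp del: of_nat_add)
  qed
  moreover have "(\<lambda>i. Digit (?D i)) = (replicate j (Digit 0) @ [Digit (?D j)]) \<frown> t"
    by (auto simp: fun_eq_iff conc_def t_def nth_append less_j le_less_Suc_eq not_less)
  then have "w = s \<frown> t"
    by (simp add: x u_def s_def)
  ultimately show thesis by (rule that)
qed

lemma tails_build: "a ## t \<in> tails \<longleftrightarrow> a \<in> digit_symbols \<and> t \<in> tails"
proof -
  have "(\<forall>n. \<exists>i\<ge>n. (a ## t) i \<noteq> Digit 9) \<longleftrightarrow> (\<forall>n. \<exists>i\<ge>n. t i \<noteq> Digit 9)"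
  proof (intro iffI allI)
    fix n assume "\<forall>n. \<exists>i\<ge>n. (a ## t) i \<noteq> Digit 9"
    then obtain i where "i \<ge> Suc n" "(a ## t) i \<noteq> Digit 9" by blast
    then show "\<exists>i\<ge>n. t i \<noteq> Digit 9" by (cases i) auto
  next
    fix n assume "\<forall>n. \<exists>i\<ge>n. t i \<noteq> Digit 9"
    then obtain i where "i \<ge> n" "t i \<noteq> Digit 9" by blast
    then show "\<exists>i\<ge>n. (a ## t) i \<noteq> Digit 9" by (intro exI[of _ "Suc i"]) auto
  qed
  then show ?thesis by (auto simp: tails_def)
qed

section \<open>Transducers acting behind the leading nonzero digit\<close>

text \<open>
  State \<open>0\<close> reads the sign and the order, state \<open>1\<close> the zeros before the leading digit, state \<open>2\<close> is
  active and state \<open>3\<close> copies the rest. State \<open>2\<close> stays active as long as it reads letters from \<open>C\<close>.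
\<close>

definition tail_next :: "symbol set \<Rightarrow> nat \<Rightarrow> symbol \<Rightarrow> nat" where
  "tail_next C q a =
     (if q = 0 then (if a = Sep then 1 else 0)
      else if q = 1 then (if a = Digit 0 then 1 else 2)
      else if q = 2 \<and> a \<in> C then 2 else 3)"

definition tail_out :: "(symbol \<Rightarrow> symbol) \<Rightarrow> nat \<Rightarrow> symbol \<Rightarrow> symbol" where
  "tail_out \<rho> q a = (if q = 2 then \<rho> a else a)"

abbreviation tail_map :: "symbol set \<Rightarrow> (symbol \<Rightarrow> symbol) \<Rightarrow> nat \<Rightarrow> symbol word \<Rightarrow> symbol word" where
  "tail_map C \<rho> \<equiv> mealy (tail_next C) (tail_out \<rho>)"

lemma tail_map_3: "tail_map C \<rho> 3 w = w"
proof -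
  have "mealy_state (tail_next C) 3 w i = 3" for i
    by (induction i) (simp_all add: tail_next_def)
  then show ?thesis by (simp add: mealy_def tail_out_def)
qed

lemma tail_map_2_build:
  "tail_map C \<rho> 2 (a ## w) = \<rho> a ## (if a \<in> C then tail_map C \<rho> 2 w else w)"
  by (simp add: mealy_build tail_out_def tail_next_def tail_map_3)

lemma tail_map_stem:
  assumes "stem s"
  shows "tail_map C \<rho> 0 (s \<frown> w) = s \<frown> tail_map C \<rho> 2 w"
proof (rule mealy_copies)
  let ?copies = "copies (tail_next C) (tail_out \<rho>)"
  obtain sg k j c where
    s: "s = ((if sg then [Minus] else []) @ map Digit (binary k) @ [Sep]) @
       replicate j (Digit 0) @ [Digit c]" and c: "0 < c"
    using assms unfolding stem_def by metis
  have sign_order: "?copies 0 ((if sg then [Minus] else []) @ map Digit (binary k)) 0"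
    by (rule copies_loop) (auto simp: tail_next_def tail_out_def)
  have sep: "?copies 0 [Sep] 1"
    by (simp add: tail_next_def tail_out_def)
  have zeros: "?copies 1 (replicate j (Digit 0)) 1"
    by (rule copies_loop) (auto simp: tail_next_def tail_out_def)
  have lead: "?copies 1 [Digit c] 2"
    using c by (simp add: tail_next_def tail_out_def)
  show "?copies 0 s 2"
    using copies_append[OF copies_append[OF sign_order sep] copies_append[OF zeros lead]]
    by (simp add: s)
qed

lemma tail_map_zero_word: "tail_map C \<rho> 0 zero_word = zero_word"
proof -
  have "mealy_state (tail_next C) 1 (\<lambda>_. Digit 0) i = 1" for i
    by (induction i) (simp_all add: tail_next_def)
  then have "tail_map C \<rho> 1 (\<lambda>_. Digit 0) = (\<lambda>_. Digit 0)"
    by (simp add: mealy_def tail_out_def)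
  then show ?thesis
    by (simp add: zero_word_def mealy_build tail_next_def tail_out_def)
qed

lemma bij_tail_map: "bij \<rho> \<Longrightarrow> bij (tail_map C \<rho> q)"
proof (rule bij_mealy)
  fix q assume "bij \<rho>"
  moreover have "tail_out \<rho> q = (if q = 2 then \<rho> else id)"
    by (auto simp: tail_out_def fun_eq_iff)
  ultimately show "bij (tail_out \<rho> q)" by simp
qed

text \<open>
  The transducer keeps the stem of a word and acts on its tail alone, so bijectivity and the period
  are inherited from the action of state \<open>2\<close> on the tails.
\<close>

lemma uniform_period_tail_map:
  assumes "bij \<rho>"
    and tails: "\<And>t. tail_map C \<rho> 2 t \<in> tails \<longleftrightarrow> t \<in> tails"
    and per: "\<And>t k. t \<in> tails \<Longrightarrow> (tail_map C \<rho> 2 ^^ k) t = t \<longleftrightarrow> n dvd k"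
  shows "uniform_period (tail_map C \<rho> 0) nonzero_words n"
  unfolding uniform_period_def
proof (intro conjI ballI allI)
  let ?G = "tail_map C \<rho> 0" and ?H = "tail_map C \<rho> 2"
  have "inj ?G" using bij_tail_map[OF assms(1)] by (simp add: bij_def)
  moreover have "?G ` nonzero_words \<subseteq> nonzero_words"
  proof safe
    fix w assume "w \<in> nonzero_words"
    then obtain s t where "stem s" "t \<in> tails" "w = s \<frown> t" by (rule nonzero_words_split)
    then show "?G w \<in> nonzero_words"
      using tails by (simp add: tail_map_stem stem_conc_tail)
  qed
  moreover have "nonzero_words \<subseteq> ?G ` nonzero_words"
  proof
    fix w assume "w \<in> nonzero_words"
    then obtain s t where st: "stem s" "t \<in> tails" "w = s \<frown> t" by (rule nonzero_words_split)
    obtain t' where t': "t = ?H t'" using bij_tail_map[OF assms(1)] by (metis bij_pointE)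
    then have "t' \<in> tails" using st(2) tails by simp
    then have "s \<frown> t' \<in> nonzero_words" using st(1) by (simp add: stem_conc_tail)
    moreover have "w = ?G (s \<frown> t')" using st t' by (simp add: tail_map_stem)
    ultimately show "w \<in> ?G ` nonzero_words" by blast
  qed
  ultimately show "bij_betw ?G nonzero_words nonzero_words"
    by (auto simp: bij_betw_def intro: inj_on_subset)
next
  fix w k assume "w \<in> nonzero_words"
  then obtain s t where st: "stem s" "t \<in> tails" "w = s \<frown> t" by (rule nonzero_words_split)
  have "(tail_map C \<rho> 0 ^^ k) (s \<frown> t) = s \<frown> (tail_map C \<rho> 2 ^^ k) t"
    by (induction k) (simp_all add: tail_map_stem st(1))
  then show "(tail_map C \<rho> 0 ^^ k) w = w \<longleftrightarrow> n dvd k"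
    using st per by simp
qed

section \<open>Transducers of periods one, two and zero\<close>

lemma uniform_period_identity: "uniform_period (tail_map {} id 0) nonzero_words 1"
proof -
  have id: "tail_map {} id 2 = id"
    by (auto simp: fun_eq_iff mealy_def tail_out_def)
  show ?thesis
    by (rule uniform_period_tail_map) (simp_all add: id)
qed

text \<open>
  Exchanges \<open>2i\<close> and \<open>2i + 1\<close>; no digit is fixed and \<open>{0..9}\<close> is preserved because it has an even
  number of elements.
\<close>

definition flip :: "symbol \<Rightarrow> symbol" where
  "flip a = (case a of Digit c \<Rightarrow> Digit (if even c then c + 1 else c - 1) | _ \<Rightarrow> a)"

lemma flip_flip: "flip (flip a) = a"
  by (auto simp: flip_def split: symbol.splits)

lemma flip_in_digit_symbols: "flip a \<in> digit_symbols \<longleftrightarrow> a \<in> digit_symbols"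
proof -
  have "flip a \<in> digit_symbols" if a: "a \<in> digit_symbols" for a
  proof -
    obtain c where c: "a = Digit c" "c \<le> 9" using a by auto
    have "c \<noteq> 9" if "even c" using that by auto
    then show ?thesis using c by (auto simp: flip_def)
  qed
  then show ?thesis by (metis flip_flip)
qed

lemma funpow_flip: "a \<in> digit_symbols \<Longrightarrow> (flip ^^ k) a = a \<longleftrightarrow> even k"
proof -
  assume a: "a \<in> digit_symbols"
  then obtain c where "a = Digit c" by blast
  then have "flip a \<noteq> a" by (cases "even c") (auto simp: flip_def dest: odd_pos)
  moreover have "(flip ^^ k) a = (if even k then a else flip a)"
    by (induction k) (simp_all add: flip_flip)
  ultimately show ?thesis by simp
qed

text \<open>
  With no carry letters, only the first digit of the tail is exchanged.
\<close>

lemma uniform_period_flip: "uniform_period (tail_map {} flip 0) nonzero_words 2"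
proof (rule uniform_period_tail_map)
  show "bij flip" by (rule o_bij[of flip]) (simp_all add: fun_eq_iff flip_flip)
  have H: "tail_map {} flip 2 t = flip (t 0) ## suffix 1 t" for t
    using tail_map_2_build[of "{}" flip "t 0" "suffix 1 t"] by (simp del: build_first)
  have split: "t = t 0 ## suffix 1 t" for t :: "symbol word" by (rule build_split)
  show "tail_map {} flip 2 t \<in> tails \<longleftrightarrow> t \<in> tails" for t
    using split[of t] by (metis H tails_build flip_in_digit_symbols)
  fix t :: "symbol word" and k assume "t \<in> tails"
  then have a: "t 0 \<in> digit_symbols" using split[of t] tails_build by metis
  have "(tail_map {} flip 2 ^^ k) t = (flip ^^ k) (t 0) ## suffix 1 t"
  proof (induction k)
    case 0
    show ?case using split[of t] by (simp only: funpow.simps id_apply)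
  next
    case (Suc k)
    then show ?case by (simp add: tail_map_2_build)
  qed
  then show "(tail_map {} flip 2 ^^ k) t = t \<longleftrightarrow> 2 dvd k"
    using funpow_flip[OF a] split[of t] build_eq by metis
qed

text \<open>
  Adds one modulo nine to the digits \<open>0\<close>, ..., \<open>8\<close>. Fixing \<open>9\<close> makes it impossible to create or destroy a
  tail of nines.
\<close>

definition cycle9 :: "symbol \<Rightarrow> symbol" where
  "cycle9 a = (case a of
     Digit c \<Rightarrow> Digit (if c < 8 then c + 1 else if c = 8 then 0 else c) | _ \<Rightarrow> a)"

definition uncycle9 :: "symbol \<Rightarrow> symbol" where
  "uncycle9 a = (case a of
     Digit c \<Rightarrow> Digit (if c = 0 then 8 else if c \<le> 8 then c - 1 else c) | _ \<Rightarrow> a)"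

lemma bij_cycle9: "bij cycle9"
  by (rule o_bij[of uncycle9]) (auto simp: fun_eq_iff cycle9_def uncycle9_def split: symbol.splits)

lemma cycle9_in_digit_symbols: "cycle9 a \<in> digit_symbols \<longleftrightarrow> a \<in> digit_symbols"
  by (auto simp: cycle9_def image_iff split: symbol.splits)

lemma cycle9_eq_9: "cycle9 a = Digit 9 \<longleftrightarrow> a = Digit 9"
  by (auto simp: cycle9_def split: symbol.splits if_splits)

text \<open>
  The carry moves on behind a digit \<open>8\<close>, which overflows to \<open>0\<close>, and passes through every digit \<open>9\<close>.
\<close>

abbreviation odometer :: "symbol word \<Rightarrow> symbol word" where
  "odometer \<equiv> tail_map {Digit 8, Digit 9} cycle9 2"

lemma odometer_in_tails: "odometer t \<in> tails \<longleftrightarrow> t \<in> tails"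
proof -
  have "odometer t i = t i \<or> odometer t i = cycle9 (t i)" for i
    by (simp add: mealy_def tail_out_def)
  then have "odometer t i \<in> digit_symbols \<longleftrightarrow> t i \<in> digit_symbols"
    and "odometer t i = Digit 9 \<longleftrightarrow> t i = Digit 9" for i
    using cycle9_in_digit_symbols[of "t i"] cycle9_eq_9[of "t i"] by metis+
  then show ?thesis by (simp add: tails_def image_subset_iff)
qed

lemma odometer_build:
  "c < 8 \<Longrightarrow> odometer (Digit c ## t) = Digit (c + 1) ## t"
  "odometer (Digit 8 ## t) = Digit 0 ## odometer t"
  "odometer (Digit 9 ## t) = Digit 9 ## odometer t"
  by (simp_all add: tail_map_2_build cycle9_def)

text \<open>
  Nine steps return the first digit to \<open>0\<close> and send one carry to the rest.
\<close>

lemma funpow_odometer_0: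
  "(odometer ^^ k) (Digit 0 ## t) = Digit (k mod 9) ## (odometer ^^ (k div 9)) t"
proof (induction k)
  case 0
  show ?case by simp
next
  case (Suc k)
  show ?case
  proof (cases "k mod 9 = 8")
    case True
    then have "Suc k mod 9 = 0" "Suc k div 9 = Suc (k div 9)" by (simp_all add: mod_Suc div_Suc)
    then show ?thesis using Suc True by (simp add: odometer_build)
  next
    case False
    moreover have "k mod 9 < 9" by simp
    ultimately have "k mod 9 < 8" by linarith
    moreover from False have "Suc k mod 9 = k mod 9 + 1" "Suc k div 9 = k div 9"
      by (simp_all add: mod_Suc div_Suc)
    ultimately show ?thesis using Suc by (simp add: odometer_build)
  qed
qed

lemma funpow_odometer:
  assumes "c \<le> 8"
  shows "(odometer ^^ k) (Digit c ## t) = Digit ((k + c) mod 9) ## (odometer ^^ ((k + c) div 9)) t"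
proof -
  have "(odometer ^^ c) (Digit 0 ## t) = Digit c ## t"
    using assms by (simp add: funpow_odometer_0)
  then have "(odometer ^^ k) (Digit c ## t) = (odometer ^^ (k + c)) (Digit 0 ## t)"
    by (simp add: funpow_add)
  then show ?thesis by (simp only: funpow_odometer_0)
qed

lemma funpow_odometer_9: "(odometer ^^ k) (Digit 9 ## t) = Digit 9 ## (odometer ^^ k) t"
  by (induction k) (simp_all add: odometer_build)

text \<open>
  If \<open>k\<close> steps fix a tail, its first digit other than \<open>9\<close> forces \<open>k\<close> to be a multiple of nine, and
  then \<open>k div 9\<close> steps fix the tail behind that digit. Descent on \<open>k\<close> gives \<open>k = 0\<close>.
\<close>

lemma odometer_aperiodic: "t \<in> tails \<Longrightarrow> (odometer ^^ k) t = t \<Longrightarrow> k = 0"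
proof (induction k arbitrary: t rule: less_induct)
  case (less k)
  \<comment> \<open>The case in which the tail starts with a digit that takes part in the count.\<close>
  have active: "k = 0" if "c \<le> 8" "t \<in> tails" "(odometer ^^ k) (Digit c ## t) = Digit c ## t"
    for c t
  proof (rule ccontr)
    assume "k \<noteq> 0"
    have mod: "(k + c) mod 9 = c" and div: "(odometer ^^ ((k + c) div 9)) t = t"
      using that funpow_odometer[OF that(1), of k t] by auto
    have k: "k = 9 * ((k + c) div 9)" using mod div_mult_mod_eq[of "k + c" 9] by linarith
    then have "(k + c) div 9 < k" using \<open>k \<noteq> 0\<close> by linarith
    then have "(k + c) div 9 = 0" using less.IH that(2) div by blast
    then show False using k \<open>k \<noteq> 0\<close> by linarith
  qed
  \<comment> \<open>Leading nines are passed through, by induction on a position \<open>i\<close> that does not carry a nine.\<close>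
  have "k = 0" if "t i \<noteq> Digit 9" "t \<in> tails" "(odometer ^^ k) t = t" for i t
    using that
  proof (induction i arbitrary: t)
    case 0
    obtain a t' where t: "t = a ## t'" using build_split by blast
    then obtain c where c: "a = Digit c" "c \<le> 9" "t' \<in> tails"
      using 0 tails_build[of a t'] by auto
    then have "c \<le> 8" using 0 t by (cases "c = 9") simp_all
    then show ?case using active[of c t'] c 0 t by simp
  next
    case (Suc i)
    obtain a t' where t: "t = a ## t'" using build_split by blast
    then obtain c where c: "a = Digit c" "c \<le> 9" "t' \<in> tails"
      using Suc.prems tails_build[of a t'] by auto
    show ?case
    proof (cases "c = 9")
      case True
      then have "(odometer ^^ k) t' = t'" "t' i \<noteq> Digit 9"
        using Suc.prems c t by (simp_all add: funpow_odometer_9)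
      then show ?thesis using Suc.IH c(3) by blast
    next
      case False
      then show ?thesis using active[of c t'] c Suc.prems t by simp
    qed
  qed
  moreover obtain i where "t i \<noteq> Digit 9"
    using less.prems(1) by (auto simp: tails_def)
  ultimately show ?case using less.prems by blast
qed

lemma uniform_period_odometer:
  "uniform_period (tail_map {Digit 8, Digit 9} cycle9 0) nonzero_words 0"
proof (rule uniform_period_tail_map)
  fix t k assume "t \<in> tails"
  then show "(odometer ^^ k) t = t \<longleftrightarrow> 0 dvd k" using odometer_aperiodic by auto
qed (simp_all add: bij_cycle9 odometer_in_tails)

section \<open>The multiplicative shift\<close>

lemma mult_shift_u: "mult_shift d (u x) = u (d \<cdot>\<^sub>R x)"
  by (simp add: mult_shift_def inv_f_f[OF inj_u])

text \<open>
  The \<open>k\<close>-th iterate multiplies the value by \<open>val d ^ k\<close>, which fixes a nonzero value exactly if this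
  power is \<open>1\<close>.
\<close>

lemma uniform_period_mult_shift:
  assumes d: "val d \<noteq> 0" and per: "\<And>k. val d ^ k = 1 \<longleftrightarrow> n dvd k"
  shows "uniform_period (mult_shift d) nonzero_words n"
  unfolding uniform_period_def
proof (intro conjI ballI allI)
  have "inj_on (mult_shift d) nonzero_words"
  proof (rule inj_onI)
    fix v w assume "v \<in> nonzero_words" "w \<in> nonzero_words" and eq: "mult_shift d v = mult_shift d w"
    then obtain x y where xy: "v = u x" "w = u y" by (auto simp: nonzero_words_def)
    then have "val d * val x = val d * val y"
      using eq inj_u by (metis injD mult_shift_u val_mult)
    then show "v = w" using d xy val_inject by simp
  qed
  moreover have "mult_shift d ` nonzero_words \<subseteq> nonzero_words"
    using d by (auto simp: nonzero_words_def mult_shift_u val_mult)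
  moreover have "nonzero_words \<subseteq> mult_shift d ` nonzero_words"
  proof
    fix w assume "w \<in> nonzero_words"
    then obtain y where y: "w = u y" "val y \<noteq> 0" by (auto simp: nonzero_words_def)
    obtain x where x: "val x = val y / val d" using val_surj by blast
    then have "d \<cdot>\<^sub>R x = y" using d by (simp add: val_mult flip: val_inject)
    then have "w = mult_shift d (u x)" using y by (simp add: mult_shift_u)
    moreover have "val x \<noteq> 0" using x y d by simp
    ultimately show "w \<in> mult_shift d ` nonzero_words" by (auto simp: nonzero_words_def)
  qed
  ultimately show "bij_betw (mult_shift d) nonzero_words nonzero_words"
    by (auto simp: bij_betw_def)
next
  fix w k assume "w \<in> nonzero_words"
  then obtain x where x: "w = u x" "val x \<noteq> 0" by (auto simp: nonzero_words_def)
  have "\<exists>y. (mult_shift d ^^ k) w = u y \<and> val y = val d ^ k * val x"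
  proof (induction k)
    case 0
    show ?case using x by auto
  next
    case (Suc k)
    then obtain y where "(mult_shift d ^^ k) w = u y" "val y = val d ^ k * val x" by blast
    then show ?case by (intro exI[of _ "d \<cdot>\<^sub>R y"]) (simp add: mult_shift_u val_mult)
  qed
  then obtain y where y: "(mult_shift d ^^ k) w = u y" "val y = val d ^ k * val x" by blast
  have "(mult_shift d ^^ k) w = w \<longleftrightarrow> val y = val x"
    using y(1) x(1) inj_u by (simp add: inj_eq val_inject)
  also have "\<dots> \<longleftrightarrow> n dvd k" using y(2) x(2) per by simp
  finally show "(mult_shift d ^^ k) w = w \<longleftrightarrow> n dvd k" .
qed

lemma mult_shift_zero_word: "mult_shift d zero_word = zero_word"
proof -
  obtain z where "val z = 0" using val_surj by blast
  then show ?thesis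
    using mult_shift_u[of d z] u_zero[of z] u_zero[of "d \<cdot>\<^sub>R z"] by (simp add: val_mult)
qed

lemma computable_cong:
  assumes "computable A X F" "\<And>w. w \<in> X \<Longrightarrow> F' w = F w"
  shows "computable A X F'"
proof -
  obtain M where M: "encoding A X" "F \<in> X \<rightarrow> X" "unary_machine A M" "computes M X F"
    using assms(1) unfolding computable_def by blast
  have "F' \<in> X \<rightarrow> X" using M(2) assms(2) by auto
  moreover have "computes M X F'"
    unfolding computes_def
  proof (intro ballI allI)
    fix w m assume w: "w \<in> X"
    then show "\<exists>n i j. (step M (input_tape w) ^^ n) (initial_config M m) =
        (final M, i, j, \<lambda>l. if l = 0 then F' w m else Blank)"
      using M(4) unfolding computes_def assms(2)[OF w] by blast
  qed
  ultimately show ?thesis using M unfolding computable_def by blast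
qed

lemma Blank_notin_A_R: "Blank \<notin> A_R"
  by (auto simp: A_R_def)

lemma computable_tail_map:
  assumes per: "uniform_period (tail_map C \<rho> 0) nonzero_words n"
    and \<rho>: "\<And>a. a \<in> A_R \<Longrightarrow> \<rho> a \<in> A_R"
  shows "computable A_R X_R (tail_map C \<rho> 0)"
proof (rule computable_mealy[OF encoding_X_R Blank_notin_A_R, where Q = "{0, 1, 2, 3}"])
  have "bij_betw (tail_map C \<rho> 0) nonzero_words nonzero_words"
    using per by (simp add: uniform_period_def)
  then show "tail_map C \<rho> 0 \<in> X_R \<rightarrow> X_R"
    using bij_betwE by (fastforce simp: X_R_eq tail_map_zero_word)
qed (auto simp: tail_next_def tail_out_def \<rho>)

text \<open>
  The two maps are conjugate on the nonzero words, and the conjugating permutation extends to \<open>X_R\<close> by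
  fixing the word of zero, which both maps fix.
\<close>

lemma conjugate_computable:
  assumes f: "uniform_period (mult_shift d) nonzero_words n"
    and g: "uniform_period g nonzero_words n" "g zero_word = zero_word"
    and comp: "computable A_R X_R g"
  shows "\<exists>\<pi>. bij_betw \<pi> X_R X_R \<and> computable A_R X_R (conjugate X_R \<pi> (mult_shift d))"
proof -
  obtain \<pi> where \<pi>: "bij_betw \<pi> nonzero_words nonzero_words"
    "\<And>w. w \<in> nonzero_words \<Longrightarrow> \<pi> (mult_shift d w) = g (\<pi> w)"
    using uniform_period_conjugate[OF f g(1) uncountable_nonzero_words] by blast
  define \<pi>' where "\<pi>' = \<pi>(zero_word := zero_word)"
  have \<pi>': "\<pi>' w = \<pi> w" if "w \<in> nonzero_words" for w
    using that zero_word_notin by (auto simp: \<pi>'_def)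
  have "bij_betw \<pi>' nonzero_words nonzero_words"
    using \<pi>(1) \<pi>' bij_betw_cong by metis
  then have bij: "bij_betw \<pi>' X_R X_R"
    using zero_word_notin bij_betw_combine[of \<pi>' nonzero_words nonzero_words "{zero_word}" "{zero_word}"]
    by (simp add: X_R_eq \<pi>'_def)
  have comm: "\<pi>' (mult_shift d w) = g (\<pi>' w)" if "w \<in> X_R" for w
  proof (cases "w = zero_word")
    case True
    then show ?thesis by (simp add: mult_shift_zero_word g(2) \<pi>'_def)
  next
    case False
    then have w: "w \<in> nonzero_words" using that by (simp add: X_R_eq)
    then have "mult_shift d w \<in> nonzero_words"
      using f bij_betwE unfolding uniform_period_def by blast
    then show ?thesis using w by (simp add: \<pi>' \<pi>(2))
  qed
  have "conjugate X_R \<pi>' (mult_shift d) w = g w" if "w \<in> X_R" for w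
    using comm[OF bij_betwE[OF bij_betw_inv_into[OF bij], rule_format, OF that]]
      bij_betw_inv_into_right[OF bij that] by (simp add: conjugate_def)
  then have "computable A_R X_R (conjugate X_R \<pi>' (mult_shift d))"
    using comp computable_cong by blast
  then show ?thesis using bij by blast
qed

text \<open>
  A transducer that ignores its input and only counts the first two letters.
\<close>

lemma computable_const_zero_word: "computable A_R X_R (\<lambda>_. zero_word)"
proof -
  define \<delta> :: "nat \<Rightarrow> symbol \<Rightarrow> nat" where "\<delta> q a = (if q = 0 then 1 else 2)" for q a
  define out :: "nat \<Rightarrow> symbol \<Rightarrow> symbol" where "out q a = (if q = 1 then Sep else Digit 0)" for q a
  have "mealy_state \<delta> 0 w i = min i 2" for w i
    by (induction i) (auto simp: \<delta>_def)
  then have eq: "mealy \<delta> out 0 = (\<lambda>_. zero_word)"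
    by (auto simp: fun_eq_iff mealy_def out_def zero_word_def conc_def nth_Cons split: nat.splits)
  have "computable A_R X_R (mealy \<delta> out 0)"
    by (rule computable_mealy[OF encoding_X_R Blank_notin_A_R, where Q = "{0, 1, 2}"])
       (auto simp: eq X_R_eq \<delta>_def out_def A_R_def)
  then show ?thesis by (simp add: eq)
qed

theorem theorem5p4:
  fixes d :: decimal
  shows "\<exists>\<pi>. bij_betw \<pi> X_R X_R \<and> computable A_R X_R (conjugate X_R \<pi> (mult_shift d))"
proof -
  consider "val d = 0" | "val d = 1" | "val d = - 1" | "val d \<noteq> 0" "\<bar>val d\<bar> \<noteq> 1"
    by fastforce
  then show ?thesis
  proof cases
    case 1
    have "mult_shift d w = zero_word" if w: "w \<in> X_R" for w
    proof -
      obtain x where "w = u x" using w by (auto simp: X_R_def)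
      then show ?thesis by (simp add: mult_shift_u u_zero val_mult 1)
    qed
    then have "conjugate X_R id (mult_shift d) w = zero_word" if "w \<in> X_R" for w
      using that bij_betw_inv_into_right[OF bij_betw_id that] by (simp add: conjugate_def)
    then have "computable A_R X_R (conjugate X_R id (mult_shift d))"
      using computable_cong[OF computable_const_zero_word] by blast
    then show ?thesis using bij_betw_id by blast
  next
    case 2
    then have "uniform_period (mult_shift d) nonzero_words 1"
      by (intro uniform_period_mult_shift) simp_all
    then show ?thesis
      by (rule conjugate_computable[OF _ uniform_period_identity tail_map_zero_word])
         (rule computable_tail_map[OF uniform_period_identity], simp)
  next
    case 3
    have "val d ^ k = 1 \<longleftrightarrow> 2 dvd k" for k
      unfolding 3 by (cases "even k") simp_all
    then have "uniform_period (mult_shift d) nonzero_words 2"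
      using 3 by (intro uniform_period_mult_shift) simp_all
    moreover have "flip a \<in> A_R" if "a \<in> A_R" for a
    proof (cases "a \<in> digit_symbols")
      case True
      then show ?thesis using flip_in_digit_symbols by (simp add: A_R_def)
    next
      case False
      then show ?thesis using that by (auto simp: A_R_def flip_def)
    qed
    ultimately show ?thesis
      using conjugate_computable[OF _ uniform_period_flip tail_map_zero_word]
        computable_tail_map[OF uniform_period_flip] by blast
  next
    case 4
    have "k = 0" if "val d ^ k = 1" for k
      using that 4 power_eq_1_iff by fastforce
    then have "uniform_period (mult_shift d) nonzero_words 0"
      using 4 by (intro uniform_period_mult_shift) auto
    moreover have "cycle9 a \<in> A_R" if "a \<in> A_R" for a
    proof (cases "a \<in> digit_symbols")
      case True
      then show ?thesis using cycle9_in_digit_symbols by (simp add: A_R_def)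
    next
      case False
      then show ?thesis using that by (auto simp: A_R_def cycle9_def)
    qed
    ultimately show ?thesis
      using conjugate_computable[OF _ uniform_period_odometer tail_map_zero_word]
        computable_tail_map[OF uniform_period_odometer] by blast
  qed
qed

end
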